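(* Assume $\mathfrak p<\mathfrak t$ and let $\lambda=\mathfrak p$. Then there is a regular cardinal $\kappa$ with $\aleph_1\le\kappa<\lambda$ such that a $(\kappa,\lambda)$-peculiar cut in ${}^\omega\omega$ exists.
   Context: $[\omega]^{\aleph_0}$ is the set of infinite subsets of $\omega$; $A\subseteq^*B$ means $A\setminus B$ is finite. $\mathfrak p$ is the least cardinality of a family $\mathcal B\subseteq[\omega]^{\aleph_0}$ all of whose finite subfamilies have infinite intersection but with no $A\in[\omega]^{\aleph_0}$ satisfying $A\subseteq^*B$ for all $B\in\mathcal B$; $\mathfrak t$ is the least length of a $\subseteq^*$-decreasing sequence in $[\omega]^{\aleph_0}$ with no such $A$. For $f,g\in{}^\omega\omega$: $f\le^*g$ iff $f(n)\le g(n)$ for all but finitely many $n$; $f<^*g$ iff $f(n)<g(n)$ for all but finitely many $n$. For infinite regular cardinals $\kappa_1,\kappa_2$, a $(\kappa_1,\kappa_2)$-peculiar cut in ${}^\omega\omega$ is a pair $(\langle f_i:i<\kappa_1\rangle,\langle f^\alpha:\alpha<\kappa_2\rangle)$ of sequences in ${}^\omega\omega$ such that: ($\alpha$) $f_j<^*f_i$ for $i<j<\kappa_1$; ($\beta$) $f^\alpha<^*f^\beta$ for $\alpha<\beta<\kappa_2$; ($\gamma$) $f^\alpha<^*f_i$ for all $i<\kappa_1$, $\alpha<\kappa_2$; ($\delta$) if $f\in{}^\omega\omega$ and $f\le^*f_i$ for all $i<\kappa_1$, then $f\le^*f^\alpha$ for some $\alpha<\kappa_2$; ($\varepsilon$)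 if $f\in{}^\omega\omega$ and $f^\alpha\le^*f$ for all $\alpha<\kappa_2$, then $f_i\le^*f$ for some $i<\kappa_1$. *)

theory Defs
  imports Main
begin

unbundle cardinal_syntax

definition almost_sub :: "nat set \<Rightarrow> nat set \<Rightarrow> bool" where
  "almost_sub A B \<longleftrightarrow> finite (A - B)"

definition pseudo_intersection :: "nat set \<Rightarrow> nat set set \<Rightarrow> bool" where
  "pseudo_intersection A \<B> \<longleftrightarrow> infinite A \<and> (\<forall>B\<in>\<B>. almost_sub A B)"

definition p_family :: "nat set set \<Rightarrow> bool" where
  "p_family \<B> \<longleftrightarrow>
     (\<forall>B\<in>\<B>. infinite B) \<and>
     (\<forall>\<F>. finite \<F> \<and> \<F> \<subseteq> \<B> \<longrightarrow> infinite (\<Inter>\<F>)) \<and>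
     \<not> (\<exists>A. pseudo_intersection A \<B>)"

definition tower :: "'i rel \<Rightarrow> ('i \<Rightarrow> nat set) \<Rightarrow> bool" where
  "tower r T \<longleftrightarrow> Well_order r \<and>
     (\<forall>i\<in>Field r. infinite (T i)) \<and>
     (\<forall>i\<in>Field r. \<forall>j\<in>Field r. (i, j) \<in> r \<longrightarrow> almost_sub (T j) (T i)) \<and>
     \<not> (\<exists>A. pseudo_intersection A (T ` Field r))"

text \<open>The cardinal p, represented by a cardinal order (on nat set,
  which is large enough since p is at most the continuum).\<close>
definition is_p :: "nat set rel \<Rightarrow> bool" where
  "is_p l \<longleftrightarrow> Card_order l \<and>
     (\<exists>\<B>. p_family \<B> \<and> card_of \<B> =o l) \<and>
     (\<forall>\<B>. p_family \<B> \<longrightarrow> l \<le>o card_of \<B>)"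

text \<open>The ordinal t: least order type of a tower (towers indexed on nat set,
  enough since t is at most the continuum).\<close>
definition is_t :: "nat set rel \<Rightarrow> bool" where
  "is_t l \<longleftrightarrow> Well_order l \<and>
     (\<exists>r T. tower (r :: nat set rel) T \<and> r =o l) \<and>
     (\<forall>(r :: nat set rel) T. tower r T \<longrightarrow> l \<le>o r)"

definition p_less_t :: bool where
  "p_less_t \<longleftrightarrow> (\<exists>lp lt. is_p lp \<and> is_t lt \<and> lp <o lt)"

definition le_star :: "(nat \<Rightarrow> nat) \<Rightarrow> (nat \<Rightarrow> nat) \<Rightarrow> bool" where
  "le_star f g \<longleftrightarrow> finite {n. \<not> f n \<le> g n}"

definition less_star :: "(nat \<Rightarrow> nat) \<Rightarrow> (nat \<Rightarrow> nat) \<Rightarrow> bool" where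
  "less_star f g \<longleftrightarrow> finite {n. \<not> f n < g n}"

text \<open>A (k1,k2)-peculiar cut; sequences are indexed by the fields of the
  cardinal (initial ordinal) well-orders k1 and k2.\<close>
definition peculiar_cut ::
  "'a rel \<Rightarrow> 'b rel \<Rightarrow> ('a \<Rightarrow> nat \<Rightarrow> nat) \<Rightarrow> ('b \<Rightarrow> nat \<Rightarrow> nat) \<Rightarrow> bool" where
  "peculiar_cut k1 k2 F G \<longleftrightarrow>
     (\<forall>i\<in>Field k1. \<forall>j\<in>Field k1. (i, j) \<in> k1 \<and> i \<noteq> j \<longrightarrow> less_star (F j) (F i)) \<and>
     (\<forall>a\<in>Field k2. \<forall>b\<in>Field k2. (a, b) \<in> k2 \<and> a \<noteq> b \<longrightarrow> less_star (G a) (G b)) \<and>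
     (\<forall>i\<in>Field k1. \<forall>a\<in>Field k2. less_star (G a) (F i)) \<and>
     (\<forall>f. (\<forall>i\<in>Field k1. le_star f (F i)) \<longrightarrow> (\<exists>a\<in>Field k2. le_star f (G a))) \<and>
     (\<forall>f. (\<forall>a\<in>Field k2. le_star (G a) f) \<longrightarrow> (\<exists>i\<in>Field k1. le_star (F i) f))"

definition aleph1_le :: "'a rel \<Rightarrow> bool" where
  "aleph1_le k \<longleftrightarrow> natLeq <o k"

definition ord_less :: "'a rel \<Rightarrow> 'b rel \<Rightarrow> bool" where
  "ord_less a b \<longleftrightarrow> a <o b"

end

theory Submission
  imports Defs "HOL-Library.Infinite_Set" "HOL-Library.Countable_Set_Type"
begin

text \<open>
Let \<open>e\<^sub>a\<close> (\<open>a < \<lambda>\<close>) be a witness for p, closed under finite intersections, and call a set positive if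
it meets every \<open>e\<^sub>a\<close> infinitely often. A decreasing sequence of positive sets with \<open>A\<^sub>a \<subseteq> e\<^sub>a\<close> cannot have
length \<open>\<lambda> < t\<close>, so some tower of positive sets \<open>A\<^sub>i\<close> of length below \<open>\<lambda>\<close> has no positive lower
bound; the least length \<open>\<kappa>\<close> of such a tower is regular, and uncountable because \<open>\<lambda>\<close> many functions
are dominated. Domination also gives intervals \<open>I\<^sub>n\<close> almost all of which meet every \<open>A\<^sub>i \<inter> e\<^sub>a\<close>.

Since \<open>\<kappa> < p\<close>, on an infinite set of \<open>n\<close> there are height functions on \<open>I\<^sub>n\<close> such that \<open>A\<^sub>i\<close> is
eventually the set of points of height at least \<open>u\<^sub>i(n)\<close>, where \<open>u\<^sub>i\<close> is strictly increasing in \<open>i\<close>. Let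
\<open>w\<^sub>a(n)\<close> be the largest height in \<open>e\<^sub>a \<inter> I\<^sub>n\<close>. A function \<open>k\<close> with \<open>u\<^sub>i \<le> k \<le> w\<^sub>a\<close> for all \<open>i\<close>, \<open>a\<close> on
some infinite set would make the points of height at least \<open>k(n)\<close> a positive lower bound of the
tower, so there is none. Repeated use of \<open>\<kappa> < p\<close> and \<open>\<lambda> < t\<close> replaces the \<open>w\<^sub>a\<close> by a strictly decreasing
sequence \<open>G\<^sub>a\<close> above all \<open>u\<^sub>i\<close> on one infinite set. If some \<open>k\<close> above all \<open>u\<^sub>i\<close> were not
eventually above any \<open>G\<^sub>a\<close>, the decreasing infinite sets \<open>{k < G\<^sub>a}\<close> would have a pseudo-intersection on
which \<open>k\<close> interpolates; dually for \<open>k\<close> below all \<open>G\<^sub>a\<close>. Subtracting from an upper bound reverses the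
order and gives the peculiar cut.
\<close>

section \<open>Almost inclusion\<close>

lemma almost_sub_iff_MOST: "almost_sub A B \<longleftrightarrow> (\<forall>\<^sub>\<infinity>n. n \<in> A \<longrightarrow> n \<in> B)"
  by (simp add: almost_sub_def eventually_cofinite set_diff_eq)

lemma le_star_iff_MOST: "le_star f g \<longleftrightarrow> (\<forall>\<^sub>\<infinity>n. f n \<le> g n)"
  by (simp add: le_star_def eventually_cofinite)

lemma less_star_iff_MOST: "less_star f g \<longleftrightarrow> (\<forall>\<^sub>\<infinity>n. f n < g n)"
  by (simp add: less_star_def eventually_cofinite)

lemma almost_sub_trans: "almost_sub A B \<Longrightarrow> almost_sub B C \<Longrightarrow> almost_sub A C"
  unfolding almost_sub_iff_MOST by (erule (1) eventually_elim2) blast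

lemma almost_sub_infinite: "infinite A \<Longrightarrow> almost_sub A B \<Longrightarrow> infinite (A \<inter> B)"
  unfolding almost_sub_def
  by (metis Int_Diff_Un finite_Un)

lemma infinite_imp_ex_MOST:
  assumes "infinite A" and "\<forall>\<^sub>\<infinity>n::nat. n \<in> A \<longrightarrow> P n"
  shows "\<exists>n\<ge>k. n \<in> A \<and> P n"
proof -
  have "\<exists>\<^sub>\<infinity>n. n \<in> A"
    using assms(1) by (simp add: frequently_cofinite)
  then have "\<exists>\<^sub>\<infinity>n. n \<in> A \<and> (n \<in> A \<longrightarrow> P n)"
    using assms(2) by (rule INFM_conjI)
  then show ?thesis
    unfolding INFM_nat_le by blast
qed

text \<open>Unions of sections are shown positive this way: the factor \<open>{n..}\<close> pushes
  the witnesses beyond every bound, even when the sections overlap.\<close>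

lemma infinite_Int_UN_sections:
  fixes Y :: "nat set"
  assumes "infinite Y" and "\<forall>\<^sub>\<infinity>n. n \<in> Y \<longrightarrow> D n \<inter> B \<inter> {n..} \<noteq> {}"
  shows "infinite ((\<Union>n\<in>Y. D n) \<inter> B)"
  unfolding infinite_nat_iff_unbounded_le
proof
  fix m :: nat
  obtain n where n: "n \<ge> m" "n \<in> Y" "D n \<inter> B \<inter> {n..} \<noteq> {}"
    using infinite_imp_ex_MOST[OF assms] by blast
  then obtain x where x: "x \<in> D n" "x \<in> B" "n \<le> x" by auto
  have "x \<ge> m" "x \<in> (\<Union>n\<in>Y. D n) \<inter> B" using n x by auto
  then show "\<exists>x\<ge>m. x \<in> (\<Union>n\<in>Y. D n) \<inter> B" by blast
qed

text \<open>Only finitely many sections can leave \<open>A\<close>, and each is finite.\<close>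

lemma almost_sub_UN_sections:
  assumes "\<And>n. finite (D n)" and "\<forall>\<^sub>\<infinity>n. n \<in> Y \<longrightarrow> D n \<subseteq> A"
  shows "almost_sub (\<Union>n\<in>Y. D n) A"
proof -
  let ?E = "{n. \<not> (n \<in> Y \<longrightarrow> D n \<subseteq> A)}"
  have "finite ?E" using assms(2) by (simp add: eventually_cofinite)
  then have "finite (\<Union>n\<in>?E. D n)" using assms(1) by blast
  moreover have "(\<Union>n\<in>Y. D n) - A \<subseteq> (\<Union>n\<in>?E. D n)" by blast
  ultimately show ?thesis
    unfolding almost_sub_def by (rule finite_subset[rotated])
qed

lemma MOST_image:
  assumes "\<forall>\<^sub>\<infinity>m. m \<in> W \<longrightarrow> Q (f m)"
  shows "\<forall>\<^sub>\<infinity>n. n \<in> f ` W \<longrightarrow> Q n"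
proof -
  have "{n. \<not> (n \<in> f ` W \<longrightarrow> Q n)} \<subseteq> f ` {m. \<not> (m \<in> W \<longrightarrow> Q (f m))}" by auto
  then show ?thesis
    using assms unfolding eventually_cofinite by (rule finite_subset[OF _ finite_imageI])
qed

text \<open>Diagonal choice along an enumeration of the family. This is what makes p
  uncountable.\<close>

lemma countable_pseudo_intersection:
  assumes "countable \<B>" and "\<And>\<F>. finite \<F> \<Longrightarrow> \<F> \<subseteq> \<B> \<Longrightarrow> infinite (\<Inter>\<F>)"
  shows "\<exists>A. pseudo_intersection A \<B>"
proof (cases "\<B> = {}")
  case True
  then show ?thesis
    by (auto simp: pseudo_intersection_def intro: exI[of _ UNIV])
next
  case False
  define S where "S n = (\<Inter>m\<le>n. from_nat_into \<B> m)" for n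
  have "infinite (S n)" for n
    unfolding S_def by (rule assms(2)) (auto simp: False from_nat_into)
  then have "\<exists>x\<ge>n. x \<in> S n" for n
    using infinite_nat_iff_unbounded_le by blast
  then obtain x where x: "\<And>n. x n \<ge> n" "\<And>n. x n \<in> S n"
    by metis
  have "infinite (range x)"
    unfolding infinite_nat_iff_unbounded_le using x(1) by blast
  moreover have "almost_sub (range x) B" if B: "B \<in> \<B>" for B
  proof -
    obtain m where m: "B = from_nat_into \<B> m"
      using from_nat_into_surj[OF assms(1) B] by metis
    have "range x - B \<subseteq> x ` {..<m}"
      using x(2) m unfolding S_def by (fastforce simp: not_less[symmetric])
    then show ?thesis
      unfolding almost_sub_def by (rule finite_subset) simp
  qed
  ultimately show ?thesis
    unfolding pseudo_intersection_def by blast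
qed

section \<open>Well-orders and regularity\<close>

lemma Well_order_cases:
  assumes "Well_order r" "a \<in> Field r" "b \<in> Field r"
  obtains "(a, b) \<in> r" | "(b, a) \<in> r" "a \<noteq> b"
  using assms wo_rel.TOTALS[of r] by (auto simp: wo_rel_def)

lemma Well_order_refl: "Well_order r \<Longrightarrow> a \<in> Field r \<Longrightarrow> (a, a) \<in> r"
  using wo_rel.REFL[of r] by (auto simp: wo_rel_def refl_on_def)

lemma Field_Restr_Well_order: "Well_order r \<Longrightarrow> Field (Restr r K) = Field r \<inter> K"
  by (rule Refl_Field_Restr) (simp add: wo_rel.REFL wo_rel_def)

lemma Well_order_dependent_choice:
  fixes r :: "'a rel" and P :: "('a \<Rightarrow> 'b) \<Rightarrow> 'a \<Rightarrow> 'b \<Rightarrow> bool"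
  assumes "Well_order r"
    and "\<And>f g a x. (\<And>b. b \<in> underS r a \<Longrightarrow> f b = g b) \<Longrightarrow> P f a x = P g a x"
    and "\<And>a f. a \<in> Field r \<Longrightarrow> (\<And>b. b \<in> underS r a \<Longrightarrow> P f b (f b)) \<Longrightarrow> \<exists>x. P f a x"
  shows "\<exists>f. \<forall>a\<in>Field r. P f a (f a)"
proof -
  \<comment> \<open>Wellfounded recursion runs over the whole type; the guard makes it trivial
    outside the field.\<close>
  have "\<exists>f. \<forall>a. a \<in> Field r \<longrightarrow> P f a (f a)"
  proof (rule dependent_wf_choice[where R = "r - Id" and P = "\<lambda>f a x. a \<in> Field r \<longrightarrow> P f a x"])
    show "wf (r - Id)"
      using assms(1) by (simp add: well_order_on_def)
    show "(a \<in> Field r \<longrightarrow> P f a x) = (a \<in> Field r \<longrightarrow> P g a x)"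
      if "\<And>z. (z, a) \<in> r - Id \<Longrightarrow> f z = g z" for f g a x
      using assms(2)[of a f g x] that by (auto simp: underS_def)
    show "\<exists>x. a \<in> Field r \<longrightarrow> P f a x"
      if "\<And>b. (b, a) \<in> r - Id \<Longrightarrow> b \<in> Field r \<longrightarrow> P f b (f b)" for a f
      using assms(3)[of a f] that by (auto simp: underS_def Field_def)
  qed
  then show ?thesis by blast
qed

lemma Restr_ordLeq:
  assumes r: "Well_order r"
  shows "Restr r K \<le>o r"
proof (rule ccontr)
  let ?s = "Restr r K"
  have s: "Well_order ?s" using r by (rule Well_order_Restr)
  \<comment> \<open>Otherwise \<open>r\<close> is isomorphic to a proper initial segment of its own
    restriction, by some \<open>f\<close> with \<open>f a\<close> below \<open>a\<close>. A least
    \<open>x\<close> with \<open>f x\<close> below \<open>x\<close> is impossible, since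
    \<open>f x\<close> has the same property.\<close>
  assume "\<not> ?s \<le>o r"
  then have "r <o ?s" using not_ordLeq_iff_ordLess r s by blast
  then obtain a where a: "a \<in> Field ?s" "r =o Restr ?s (underS ?s a)"
    using ordLess_iff_ordIso_Restr[OF s r] by blast
  then obtain f where f: "iso r (Restr ?s (underS ?s a)) f"
    unfolding ordIso_def by blast
  have inj: "inj_on f (Field r)" using f r by (simp add: iso_imp_inj_on)
  have step: "(f x, f y) \<in> ?s" if "(x, y) \<in> r" for x y
    using iso_forward[OF that f] by simp
  have aF: "a \<in> Field r" using a(1) Field_Restr_Well_order[OF r] by blast
  have "f a \<in> underS ?s a"
    using iso_forward[OF Well_order_refl[OF r aF] f] by simp
  then have "(f a, a) \<in> r - Id" by (auto simp: underS_def)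
  moreover have "wf (r - Id)" using r by (simp add: well_order_on_def)
  ultimately obtain x where x: "(f x, x) \<in> r - Id"
    and min: "\<And>y. (y, x) \<in> r - Id \<Longrightarrow> (f y, y) \<notin> r - Id"
    by (elim wfE_min[of "r - Id" a "{x. (f x, x) \<in> r - Id}"]) simp_all
  have "(f (f x), f x) \<in> r" using step[of "f x" x] x by simp
  moreover have "f (f x) \<noteq> f x" using inj_onD[OF inj, of "f x" x] x by (auto simp: Field_def)
  ultimately show False using min[OF x] by simp
qed

text \<open>The elements of \<open>K\<close> that are records for a second well-order of type \<open>|K|\<close> are still cofinal,
  and both orders agree on them.\<close>

lemma ordLeq_card_of_cofinal:
  assumes r: "Well_order r"
    and min: "\<And>K. K \<subseteq> Field r \<Longrightarrow> (\<And>a. a \<in> Field r \<Longrightarrow> \<exists>b\<in>K. (a, b) \<in> r) \<Longrightarrow> r \<le>o Restr r K"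
    and K: "K \<subseteq> Field r" "\<And>a. a \<in> Field r \<Longrightarrow> \<exists>b\<in>K. (a, b) \<in> r"
  shows "r \<le>o |K|"
proof -
  let ?s = "|K|"
  have s: "Well_order ?s" "Field ?s = K"
    by (rule card_of_Well_order Field_card_of)+
  have trans_r: "trans r" and antisym_r: "antisym r"
    using r wo_rel.TRANS[of r] wo_rel.ANTISYM[of r] by (simp_all add: wo_rel_def)
  have antisym_s: "antisym ?s"
    using s(1) wo_rel.ANTISYM[of ?s] by (simp add: wo_rel_def)
  define L where "L = {x \<in> K. \<forall>y. (y, x) \<in> ?s \<longrightarrow> (y, x) \<in> r}"
  have L: "L \<subseteq> Field r" using K(1) unfolding L_def by blast
  have cof: "\<exists>b\<in>L. (a, b) \<in> r" if a: "a \<in> Field r" for a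
  proof -
    \<comment> \<open>The \<open>?s\<close>-least \<open>b\<close> in \<open>K\<close> above
      \<open>a\<close> is a record: anything \<open>?s\<close>-earlier lies outside
      \<open>?U\<close>, hence below \<open>a\<close> and so below \<open>b\<close>.\<close>
    let ?U = "{b \<in> K. (a, b) \<in> r}"
    have "?U \<subseteq> Field ?s" "?U \<noteq> {}" using K(2)[OF a] s(2) by auto
    moreover have "wo_rel ?s" using s(1) by (simp add: wo_rel_def)
    moreover define b where "b = wo_rel.minim ?s ?U"
    ultimately have b: "b \<in> ?U" "\<And>c. c \<in> ?U \<Longrightarrow> (b, c) \<in> ?s"
      using wo_rel.minim_in[of ?s ?U] wo_rel.minim_least[of ?s ?U] by blast+
    have "(y, b) \<in> r" if y: "(y, b) \<in> ?s" for y
    proof -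
      have yK: "y \<in> K" using y s(2) by (auto simp: Field_def)
      then have yF: "y \<in> Field r" using K(1) by blast
      have bF: "b \<in> Field r" using b(1) K(1) by blast
      show ?thesis
      proof (cases "y = b")
        case True
        then show ?thesis using Well_order_refl[OF r bF] by simp
      next
        case False
        then have "y \<notin> ?U" using b(2)[of y] y antisym_s by (auto dest: antisymD)
        then have "(a, y) \<notin> r" using yK by blast
        then have "(y, a) \<in> r" by (rule_tac Well_order_cases[OF r a yF]) simp_all
        then show ?thesis using b(1) trans_r by (auto dest: transD)
      qed
    qed
    then have "b \<in> L" using b(1) unfolding L_def by blast
    then show ?thesis using b(1) by blast
  qed
  have "r \<le>o Restr r L" by (rule min[OF L cof])
  also have "Restr r L = Restr ?s L"
  proof -
    have "(x, y) \<in> ?s" if "(x, y) \<in> r" "x \<in> L" "y \<in> L" for x y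
    proof (rule ccontr)
      assume n: "(x, y) \<notin> ?s"
      have xy: "x \<in> Field ?s" "y \<in> Field ?s" using that s(2) unfolding L_def by auto
      have ne: "x \<noteq> y" using n Well_order_refl[OF s(1) xy(1)] by auto
      have "(y, x) \<in> ?s"
        using n by (rule_tac Well_order_cases[OF s(1) xy]) simp_all
      then have "(y, x) \<in> r" using that(2) unfolding L_def by blast
      then show False using that(1) ne antisym_r by (auto dest: antisymD)
    qed
    moreover have "(x, y) \<in> r" if "(x, y) \<in> ?s" "x \<in> L" "y \<in> L" for x y
      using that unfolding L_def by blast
    ultimately show ?thesis by auto
  qed
  also have "Restr ?s L \<le>o ?s" by (rule Restr_ordLeq[OF s(1)])
  finally show ?thesis .
qed

text \<open>Each new element is chosen beyond the previous one and beyond all values of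
  \<open>f\<close> up to it; monotonicity extends this from neighbours to all pairs.\<close>

lemma ex_thin_subset:
  fixes f :: "nat \<Rightarrow> nat"
  assumes "infinite S"
  shows "\<exists>T\<subseteq>S. infinite T \<and> (\<forall>x\<in>T. \<forall>y\<in>T. x < y \<longrightarrow> (\<forall>m\<le>x. f m \<le> y))"
proof -
  have step: "\<exists>y\<in>S. y > x \<and> (\<forall>m\<le>x. f m \<le> y)" for x
  proof -
    obtain y where y: "y > Max (insert x (f ` {..x}))" "y \<in> S"
      using assms infinite_nat_iff_unbounded by blast
    then have "\<forall>z\<in>insert x (f ` {..x}). z < y" by (subst (asm) Max_less_iff) auto
    then show ?thesis using y(2) by (intro bexI[of _ y]) (auto intro: less_imp_le)
  qed
  have "\<exists>t. \<forall>n. t n \<in> S \<and> (t (Suc n) > t n \<and> (\<forall>m\<le>t n. f m \<le> t (Suc n)))"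
    by (rule dependent_nat_choice) (use step in blast)+
  then obtain t where t: "\<And>n. t n \<in> S" "\<And>n. t n < t (Suc n)" "\<And>n m. m \<le> t n \<Longrightarrow> f m \<le> t (Suc n)"
    by blast
  have mono: "strict_mono t" using t(2) by (simp add: strict_mono_Suc_iff)
  have "\<forall>m\<le>t a. f m \<le> t b" if "t a < t b" for a b
  proof (intro allI impI)
    fix m assume "m \<le> t a"
    then have "f m \<le> t (Suc a)" by (rule t(3))
    also have "\<dots> \<le> t b"
      using that mono by (simp add: strict_mono_less strict_mono_less_eq)
    finally show "f m \<le> t b" .
  qed
  moreover have "infinite (range t)"
    using mono by (simp add: range_inj_infinite strict_mono_imp_inj_on)
  ultimately show ?thesis using t(1) by (intro exI[of _ "range t"]) auto
qed

lemma natLeq_less_uncountable: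
  assumes "uncountable A"
  shows "natLeq <o |A|"
  using assms not_ordLeq_iff_ordLess[OF natLeq_Well_order card_of_Well_order[of A]]
  by (simp add: countable_card_le_natLeq)

section \<open>Consequences of p below t\<close>

locale p_below_t =
  fixes lam lt :: "nat set rel"
  assumes is_p: "is_p lam" and is_t: "is_t lt" and lam_less: "lam <o lt"
begin

lemma Card_order_lam: "Card_order lam"
  using is_p unfolding is_p_def by blast

lemma Well_order_lam: "Well_order lam"
  using Card_order_lam unfolding card_order_on_def by blast

lemma small_pseudo_intersection:
  assumes "|\<B>| <o lam" and "\<And>\<F>. finite \<F> \<Longrightarrow> \<F> \<subseteq> \<B> \<Longrightarrow> infinite (\<Inter>\<F>)"
  shows "\<exists>A. pseudo_intersection A \<B>"
proof (rule ccontr)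
  assume "\<not> ?thesis"
  moreover have "infinite B" if "B \<in> \<B>" for B
    using assms(2)[of "{B}"] that by simp
  ultimately have "p_family \<B>" using assms(2) unfolding p_family_def by blast
  then have "lam \<le>o |\<B>|" using is_p unfolding is_p_def by blast
  then show False using assms(1) not_ordLess_ordLeq by blast
qed

lemma uncountable_lam: "natLeq <o lam"
proof -
  obtain \<B> where B: "p_family \<B>" "|\<B>| =o lam"
    using is_p unfolding is_p_def by blast
  have "uncountable \<B>"
    using countable_pseudo_intersection[of \<B>] B(1) unfolding p_family_def by blast
  then have "natLeq <o |\<B>|" by (rule natLeq_less_uncountable)
  then show ?thesis using B(2) by (rule ordLess_ordIso_trans)
qed

lemma infinite_Field_lam: "infinite (Field lam)"
proof -
  have "natLeq \<le>o |Field lam|"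
    using uncountable_lam Card_order_lam card_of_Field_ordIso ordIso_symmetric
      ordLess_imp_ordLeq ordLeq_ordIso_trans by blast
  then show ?thesis using infinite_iff_natLeq_ordLeq[of "Field lam"] by blast
qed

lemma card_nat_less_lam: "|UNIV :: nat set| <o lam"
  using card_of_nat uncountable_lam ordIso_ordLess_trans by blast

lemma ex_surj_lam:
  assumes "|J| \<le>o lam" and "J \<noteq> {}"
  shows "\<exists>q. q ` Field lam = J"
proof -
  have "|J| \<le>o |Field lam|"
    using assms(1) ordIso_symmetric[OF card_of_Field_ordIso[OF Card_order_lam]]
    by (rule ordLeq_ordIso_trans)
  then show ?thesis by (simp only: card_of_ordLeq2[OF assms(2)])
qed

text \<open>A pseudo-intersection of the sets \<open>E j\<close> and \<open>{k..} \<times> UNIV\<close> inside the countable set \<open>nat \<times> 'o\<close>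
  meets infinitely many columns; choose one point in each. Shrinking the domain to \<open>Y\<close> is what avoids
  Hausdorff gaps.\<close>

lemma selection:
  fixes E :: "'j \<Rightarrow> (nat \<times> 'o::countable) set"
  assumes J: "|J| <o lam"
    and E: "\<And>F k. finite F \<Longrightarrow> F \<subseteq> J \<Longrightarrow> \<exists>n\<ge>k. n \<in> X \<and> (\<exists>x. \<forall>j\<in>F. (n, x) \<in> E j)"
  shows "\<exists>Y c. infinite Y \<and> Y \<subseteq> X \<and> (\<forall>j\<in>J. \<forall>\<^sub>\<infinity>n. n \<in> Y \<longrightarrow> (n, c n) \<in> E j)"
proof -
  define D :: "nat \<Rightarrow> (nat \<times> 'o) set" where "D k = {(n, x). n \<ge> k \<and> n \<in> X}" for k
  \<comment> \<open>\<open>to_nat\<close> moves the problem to subsets of \<open>nat\<close>, where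
    p is defined. The sets \<open>D k\<close> keep the columns in \<open>X\<close> and push them to
    infinity.\<close>
  let ?B = "(\<lambda>j. to_nat ` E j) ` J \<union> (\<lambda>k. to_nat ` D k) ` UNIV"
  have "|?B| <o lam"
  proof (rule card_of_Un_ordLess_infinite_Field[OF infinite_Field_lam Card_order_lam])
    show "|(\<lambda>j. to_nat ` E j) ` J| <o lam"
      using card_of_image J by (rule ordLeq_ordLess_trans)
    show "|(\<lambda>k. to_nat ` D k) ` UNIV| <o lam"
      using card_of_image card_nat_less_lam by (rule ordLeq_ordLess_trans)
  qed
  moreover have "infinite (\<Inter>\<F>)" if fin: "finite \<F>" and sub: "\<F> \<subseteq> ?B" for \<F>
  proof -
    have fin': "finite (\<F> \<inter> S)" for S using fin by simp
    have "\<exists>F\<subseteq>J. finite F \<and> \<F> \<inter> (\<lambda>j. to_nat ` E j) ` J = (\<lambda>j. to_nat ` E j) ` F"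
      by (rule finite_subset_image[OF fin' Int_lower2])
    then obtain F where F: "F \<subseteq> J" "finite F" "\<F> \<inter> (\<lambda>j. to_nat ` E j) ` J = (\<lambda>j. to_nat ` E j) ` F"
      by (elim exE conjE)
    have "\<exists>K\<subseteq>UNIV. finite K \<and> \<F> \<inter> range (\<lambda>k. to_nat ` D k) = (\<lambda>k. to_nat ` D k) ` K"
      by (rule finite_subset_image[OF fin' Int_lower2])
    then obtain K where K: "finite K" "\<F> \<inter> range (\<lambda>k. to_nat ` D k) = (\<lambda>k. to_nat ` D k) ` K"
      by (elim exE conjE)
    obtain k0 where k0: "\<And>k. k \<in> K \<Longrightarrow> k \<le> k0" using K(1) finite_nat_set_iff_bounded_le[of K] by auto
    define S where "S = {(n, x). n \<ge> k0 \<and> n \<in> X \<and> (\<forall>j\<in>F. (n, x) \<in> E j)}"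
    have "infinite (fst ` S)"
      unfolding infinite_nat_iff_unbounded_le
    proof
      fix m
      obtain n x where "n \<ge> max m k0" "n \<in> X" "\<forall>j\<in>F. (n, x) \<in> E j"
        using E[OF F(2,1), of "max m k0"] by blast
      then have "n \<ge> m" "(n, x) \<in> S" unfolding S_def by auto
      then show "\<exists>n\<ge>m. n \<in> fst ` S" by force
    qed
    then have "infinite S" by (rule contrapos_nn) (rule finite_imageI)
    then have "infinite (to_nat ` S)"
      by (rule contrapos_nn) (erule finite_imageD[OF _ inj_on_subset[OF inj_to_nat subset_UNIV]])
    moreover have "to_nat ` S \<subseteq> \<Inter>\<F>"
    proof (rule Inter_greatest)
      fix B assume B: "B \<in> \<F>"
      then have "B \<in> ?B" using sub by (rule rev_subsetD)
      then consider "B \<in> (\<lambda>j. to_nat ` E j) ` F" | "B \<in> (\<lambda>k. to_nat ` D k) ` K"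
        unfolding F(3)[symmetric] K(2)[symmetric] using B by (elim UnE) simp_all
      then show "to_nat ` S \<subseteq> B"
      proof cases
        case 1
        then obtain j where j: "j \<in> F" "B = to_nat ` E j" by (elim imageE)
        have "S \<subseteq> E j" using j(1) unfolding S_def by auto
        then show ?thesis using j(2) by (simp add: image_mono)
      next
        case 2
        then obtain k where k: "k \<in> K" "B = to_nat ` D k" by (elim imageE)
        have "S \<subseteq> D k" using k0[OF k(1)] unfolding S_def D_def by auto
        then show ?thesis using k(2) by (simp add: image_mono)
      qed
    qed
    ultimately show ?thesis using finite_subset[of "to_nat ` S"] by blast
  qed
  ultimately obtain Z where "pseudo_intersection Z ?B"
    using small_pseudo_intersection[of ?B] by blast
  then have Z: "infinite Z" "\<And>j. j \<in> J \<Longrightarrow> finite (Z - to_nat ` E j)" "\<And>k. finite (Z - to_nat ` D k)"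
    unfolding pseudo_intersection_def almost_sub_def by auto
  \<comment> \<open>Decoding \<open>Z\<close> and keeping only points over \<open>X\<close> loses
    finitely many elements.\<close>
  define W where "W = {w \<in> D 0. to_nat w \<in> Z}"
  have fin: "finite (W - V)" if "finite (Z - to_nat ` V)" for V
  proof -
    have "to_nat ` (W - V) \<subseteq> Z - to_nat ` V" unfolding W_def by auto
    then have "finite (to_nat ` (W - V))" using that finite_subset by blast
    then show ?thesis by (rule finite_imageD[OF _ inj_on_subset[OF inj_to_nat subset_UNIV]])
  qed
  have "Z - (Z - to_nat ` D 0) \<subseteq> to_nat ` W" unfolding W_def by auto
  then have W: "infinite W"
    using finite_subset[of _ "to_nat ` W"] Diff_infinite_finite[OF Z(3)[of 0] Z(1)] by blast
  define c where "c n = (SOME x. (n, x) \<in> W)" for n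
  have c: "(n, c n) \<in> W" if "n \<in> fst ` W" for n
    using that unfolding c_def by (auto intro: someI)
  have "infinite (fst ` W)"
    unfolding infinite_nat_iff_unbounded_le
  proof
    fix m
    have "W - (W - D m) \<noteq> {}"
      by (rule infinite_imp_nonempty[OF Diff_infinite_finite[OF fin[OF Z(3)] W]])
    then obtain n x where "(n, x) \<in> W" "(n, x) \<in> D m" by auto
    then show "\<exists>n\<ge>m. n \<in> fst ` W" unfolding D_def by force
  qed
  moreover have "fst ` W \<subseteq> X" unfolding W_def D_def by auto
  moreover have "\<forall>\<^sub>\<infinity>n. n \<in> fst ` W \<longrightarrow> (n, c n) \<in> E j" if j: "j \<in> J" for j
  proof -
    have "{n. \<not> (n \<in> fst ` W \<longrightarrow> (n, c n) \<in> E j)} \<subseteq> fst ` (W - E j)"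
      using c by force
    then show ?thesis
      unfolding eventually_cofinite using fin[OF Z(2)[OF j]] finite_subset finite_imageI by blast
  qed
  ultimately show ?thesis by blast
qed

text \<open>By minimality of t, a sequence shorter than t is not a tower. Restricting to
  \<open>I\<close> does not lengthen the order, so recursions can apply this to initial segments of
  \<open>lam\<close>.\<close>

lemma decreasing_lower_bound:
  fixes r :: "nat set rel"
  assumes r: "Well_order r" "r <o lt" and I: "I \<subseteq> Field r" and X: "infinite X"
    and T: "\<And>i. i \<in> I \<Longrightarrow> infinite (T i)" "\<And>i. i \<in> I \<Longrightarrow> T i \<subseteq> X"
      "\<And>i j. i \<in> I \<Longrightarrow> j \<in> I \<Longrightarrow> i \<in> underS r j \<Longrightarrow> almost_sub (T j) (T i)"
  shows "\<exists>A\<subseteq>X. infinite A \<and> (\<forall>i\<in>I. almost_sub A (T i))"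
proof (cases "I = {}")
  case True
  then show ?thesis using X by blast
next
  case False
  let ?s = "Restr r I"
  have s: "Well_order ?s" "Field ?s = I"
    using Well_order_Restr[OF r(1)] Field_Restr_Well_order[OF r(1)] I by auto
  have "?s <o lt" using Restr_ordLeq[OF r(1)] r(2) by (rule ordLeq_ordLess_trans)
  then have "\<not> tower ?s T"
    using is_t not_ordLess_ordLeq unfolding is_t_def by blast
  moreover have "almost_sub (T j) (T i)" if "i \<in> I" "j \<in> I" "(i, j) \<in> r" for i j
    using that T(3)[of i j] by (cases "i = j") (auto simp: underS_def almost_sub_def)
  ultimately obtain A where "pseudo_intersection A (T ` I)"
    using s T(1) unfolding tower_def by auto
  then have A: "infinite A" "\<And>i. i \<in> I \<Longrightarrow> almost_sub A (T i)"
    unfolding pseudo_intersection_def by auto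
  \<comment> \<open>\<open>A \<inter> X\<close> is still infinite, since \<open>A\<close> is almost
    contained in some \<open>T i\<close>, which lies in \<open>X\<close>.\<close>
  obtain i where i: "i \<in> I" using False by blast
  have "infinite (A \<inter> T i)" using almost_sub_infinite[OF A(1) A(2)[OF i]] .
  then have "infinite (A \<inter> X)"
    using T(2)[OF i] by (meson finite_subset inf_mono order_refl)
  moreover have "almost_sub (A \<inter> X) (T j)" if "j \<in> I" for j
    using A(2)[OF that] unfolding almost_sub_def by (rule finite_subset[rotated]) blast
  ultimately show ?thesis by blast
qed

text \<open>An infinite set that is almost contained in a thin set for \<open>f\<close> has a next-element function
  dominating \<open>f\<close>, so it is enough to build a decreasing sequence of thin sets.\<close>

lemma dominating:
  fixes f :: "'j \<Rightarrow> nat \<Rightarrow> nat"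
  assumes "|J| \<le>o lam"
  shows "\<exists>g. \<forall>j\<in>J. \<forall>\<^sub>\<infinity>n. f j n \<le> g n"
proof (cases "J = {}")
  case False
  obtain q where q: "q ` Field lam = J"
    using ex_surj_lam[OF assms False] by (elim exE)
  define thin where "thin h T \<longleftrightarrow> (\<forall>x\<in>T. \<forall>y\<in>T. x < y \<longrightarrow> (\<forall>m\<le>x. h m \<le> y))"
    for h :: "nat \<Rightarrow> nat" and T
  have "\<exists>T. \<forall>a\<in>Field lam. infinite (T a) \<and> thin (f (q a)) (T a) \<and> (\<forall>b\<in>underS lam a. almost_sub (T a) (T b))"
  proof (rule Well_order_dependent_choice[OF Well_order_lam, where
        P = "\<lambda>T a x. infinite x \<and> thin (f (q a)) x \<and> (\<forall>b\<in>underS lam a. almost_sub x (T b))"])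
    fix a T
    assume a: "a \<in> Field lam"
      and IH: "\<And>b. b \<in> underS lam a \<Longrightarrow>
        infinite (T b) \<and> thin (f (q b)) (T b) \<and> (\<forall>c\<in>underS lam b. almost_sub (T b) (T c))"
    have sub: "underS lam a \<subseteq> Field lam" by (auto simp: underS_def Field_def)
    obtain A where A: "infinite A" "\<forall>b\<in>underS lam a. almost_sub A (T b)"
      using decreasing_lower_bound[OF Well_order_lam lam_less, of "underS lam a" UNIV T] IH sub by auto
    obtain B where B: "B \<subseteq> A" "infinite B" "thin (f (q a)) B"
      using ex_thin_subset[OF A(1), of "f (q a)"] unfolding thin_def by blast
    have "almost_sub B (T b)" if "b \<in> underS lam a" for b
      using A(2) that B(1) almost_sub_trans[of B A "T b"] by (simp add: almost_sub_def Diff_eq_empty_iff[THEN iffD2])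
    then show "\<exists>x. infinite x \<and> thin (f (q a)) x \<and> (\<forall>b\<in>underS lam a. almost_sub x (T b))"
      using B by blast
  qed auto
  then obtain T where T: "\<And>a. a \<in> Field lam \<Longrightarrow> infinite (T a)" "\<And>a. a \<in> Field lam \<Longrightarrow> thin (f (q a)) (T a)"
      "\<And>a b. a \<in> Field lam \<Longrightarrow> b \<in> underS lam a \<Longrightarrow> almost_sub (T a) (T b)"
    by blast
  obtain A where A: "infinite A" "\<And>a. a \<in> Field lam \<Longrightarrow> almost_sub A (T a)"
    using decreasing_lower_bound[OF Well_order_lam lam_less, of "Field lam" UNIV T] T(1,3) by auto
  \<comment> \<open>\<open>y\<close> is the dominating function: once \<open>x n\<close> and
    \<open>y n\<close> both lie in a thin \<open>T a\<close>, thinness applies to the argument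
    \<open>n \<le> x n\<close>.\<close>
  have "\<exists>x y. x \<in> A \<and> y \<in> A \<and> n \<le> x \<and> x < y" for n
    using A(1) infinite_nat_iff_unbounded[of A] infinite_nat_iff_unbounded_le[of A] by meson
  then obtain x y where xy: "\<And>n. x n \<in> A" "\<And>n. y n \<in> A" "\<And>n. n \<le> x n" "\<And>n. x n < y n"
    by metis
  have "\<forall>\<^sub>\<infinity>n. f j n \<le> y n" if j: "j \<in> J" for j
  proof -
    obtain a where a: "a \<in> Field lam" "j = q a" using q j by blast
    obtain k where k: "\<And>n. n \<ge> k \<Longrightarrow> n \<in> A \<Longrightarrow> n \<in> T a"
      using A(2)[OF a(1)] unfolding almost_sub_iff_MOST MOST_nat_le by blast
    have "f j n \<le> y n" if "n \<ge> k" for n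
    proof -
      have "x n \<in> T a" "y n \<in> T a"
        using k[of "x n"] k[of "y n"] xy[of n] that by auto
      then show ?thesis
        using T(2)[OF a(1)] xy[of n] a(2) unfolding thin_def by blast
    qed
    then show ?thesis unfolding MOST_nat_le by blast
  qed
  then show ?thesis by blast
qed simp

text \<open>Each function is the successor of a bound for the earlier ones, which number at most
  p.\<close>

lemma ex_strictly_increasing:
  fixes r :: "'i rel"
  assumes r: "Well_order r" "r <o lam"
  shows "\<exists>u :: 'i \<Rightarrow> nat \<Rightarrow> nat. \<forall>i\<in>Field r. (\<forall>n. 0 < u i n) \<and> (\<forall>j\<in>underS r i. \<forall>\<^sub>\<infinity>n. u j n < u i n)"
proof (rule Well_order_dependent_choice[OF r(1), where
      P = "\<lambda>u i x. (\<forall>n. 0 < x n) \<and> (\<forall>j\<in>underS r i. \<forall>\<^sub>\<infinity>n. u j n < x n)"])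
  fix i and u :: "'i \<Rightarrow> nat \<Rightarrow> nat"
  have "|underS r i| \<le>o |Field r|" by (rule card_of_mono1) (auto simp: underS_def Field_def)
  then have "|underS r i| \<le>o lam"
    using ordLess_imp_ordLeq[OF ordLess_Field[OF r(2)]] by (rule ordLeq_transitive)
  then obtain g where g: "\<forall>j\<in>underS r i. \<forall>\<^sub>\<infinity>n. u j n \<le> g n" using dominating by blast
  show "\<exists>x. (\<forall>n. 0 < x n) \<and> (\<forall>j\<in>underS r i. \<forall>\<^sub>\<infinity>n. u j n < x n)"
    by (rule exI[of _ "\<lambda>n. Suc (g n)"]) (use g in \<open>auto simp: less_Suc_eq_le\<close>)
qed auto

text \<open>Closing a witness for p under finite intersections takes countably many stages of size
  at most p, so \<open>lam\<close> still indexes the result.\<close>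

lemma ex_closed_family:
  "\<exists>e :: nat set \<Rightarrow> nat set. (\<forall>a\<in>Field lam. infinite (e a)) \<and>
     (\<forall>a\<in>Field lam. \<forall>b\<in>Field lam. \<exists>c\<in>Field lam. e c = e a \<inter> e b) \<and>
     \<not> (\<exists>A. pseudo_intersection A (e ` Field lam))"
proof -
  obtain \<B> where B: "p_family \<B>" "|\<B>| =o lam"
    using is_p unfolding is_p_def by blast
  define C where "C = rec_nat \<B> (\<lambda>n S. (\<lambda>(A, B). A \<inter> B) ` (S \<times> \<B>))"
  have C: "C 0 = \<B>" "\<And>n. C (Suc n) = (\<lambda>(A, B). A \<inter> B) ` (C n \<times> \<B>)"
    unfolding C_def by simp_all
  let ?U = "\<Union>n. C n"
  have leB: "|\<B>| \<le>o lam" using B(2) by (rule ordIso_imp_ordLeq)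
  have "|C n| \<le>o lam" for n
  proof (induction n)
    case (Suc n)
    have "|C n \<times> \<B>| \<le>o lam"
      by (rule card_of_Times_ordLeq_infinite_Field[OF infinite_Field_lam Suc leB Card_order_lam])
    then show ?case unfolding C(2) using card_of_image ordLeq_transitive by blast
  qed (simp add: C leB)
  then have U: "|?U| \<le>o lam"
    using card_of_UNION_ordLeq_infinite_Field[OF infinite_Field_lam Card_order_lam, of UNIV C]
      card_nat_less_lam ordLess_imp_ordLeq by blast
  have "\<B> \<noteq> {}"
    using B(1) countable_pseudo_intersection[of "{}"] unfolding p_family_def by auto
  then have "?U \<noteq> {}" using C(1) by blast
  then obtain e where e: "e ` Field lam = ?U" using ex_surj_lam[OF U] by blast
  have fin: "\<exists>F. finite F \<and> F \<subseteq> \<B> \<and> A = \<Inter>F" if "A \<in> C n" for A n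
    using that
  proof (induction n arbitrary: A)
    case 0
    then show ?case using C(1) by (intro exI[of _ "{A}"]) auto
  next
    case (Suc n)
    then obtain A' B' where A': "A' \<in> C n" "B' \<in> \<B>" "A = A' \<inter> B'" unfolding C(2) by auto
    obtain F where "finite F" "F \<subseteq> \<B>" "A' = \<Inter>F" using Suc.IH[OF A'(1)] by blast
    then show ?case using A' by (intro exI[of _ "insert B' F"]) auto
  qed
  have "infinite A" if A: "A \<in> ?U" for A
  proof -
    obtain n where "A \<in> C n" using A by blast
    then obtain F where F: "finite F" "F \<subseteq> \<B>" "A = \<Inter>F" using fin by blast
    then show ?thesis using B(1) unfolding p_family_def by simp
  qed
  \<comment> \<open>Members of \<open>C n\<close> are intersections of \<open>n + 1\<close> members
    of \<open>\<B>\<close>, counted with repetition; hence the \<open>Suc\<close>.\<close>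
  moreover have "A \<inter> B \<in> C (Suc (n + m))" if "A \<in> C n" "B \<in> C m" for A B n m
    using that(2)
  proof (induction m arbitrary: B)
    case 0
    then show ?case using that(1) C by auto
  next
    case (Suc m)
    then obtain A' B' where A': "A' \<in> C m" "B' \<in> \<B>" "B = A' \<inter> B'" unfolding C(2) by auto
    have "A \<inter> A' \<in> C (Suc (n + m))" by (rule Suc.IH[OF A'(1)])
    then have "(A \<inter> A') \<inter> B' \<in> C (Suc (Suc (n + m)))" using A'(2) C(2)[of "Suc (n + m)"] by auto
    then show ?case using A'(3) by (simp add: Int_assoc)
  qed
  then have "A \<inter> B \<in> ?U" if "A \<in> ?U" "B \<in> ?U" for A B
    using that by (meson UN_iff UNIV_I)
  moreover have "\<not> (\<exists>A. pseudo_intersection A ?U)"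
  proof
    assume "\<exists>A. pseudo_intersection A ?U"
    moreover have "\<B> \<subseteq> ?U" using C(1) by blast
    ultimately have "\<exists>A. pseudo_intersection A \<B>" unfolding pseudo_intersection_def by blast
    then show False using B(1) unfolding p_family_def by blast
  qed
  ultimately have U: "\<And>A. A \<in> e ` Field lam \<Longrightarrow> infinite A"
    "\<And>A B. A \<in> e ` Field lam \<Longrightarrow> B \<in> e ` Field lam \<Longrightarrow> A \<inter> B \<in> e ` Field lam"
    "\<not> (\<exists>A. pseudo_intersection A (e ` Field lam))"
    unfolding e by blast+
  have "\<exists>c\<in>Field lam. e c = e a \<inter> e b" if "a \<in> Field lam" "b \<in> Field lam" for a b
    using U(2)[OF imageI imageI, OF that] by auto
  then show ?thesis using U(1,3) by (intro exI[of _ e]) blast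
qed

end

section \<open>A tower of regular length without positive lower bound\<close>

locale p_closed_family = p_below_t +
  fixes e :: "nat set \<Rightarrow> nat set"
  assumes e_infinite: "a \<in> Field lam \<Longrightarrow> infinite (e a)"
    and e_Int: "a \<in> Field lam \<Longrightarrow> b \<in> Field lam \<Longrightarrow> \<exists>c\<in>Field lam. e c = e a \<inter> e b"
    and no_pseudo_intersection: "\<not> (\<exists>A. pseudo_intersection A (e ` Field lam))"
begin

text \<open>Positivity for the filter generated by the sets \<open>e a\<close> and the cofinite
  sets; as the \<open>e a\<close> are closed under intersection, testing each one suffices.\<close>

definition positive :: "nat set \<Rightarrow> bool" where
  "positive C \<longleftrightarrow> (\<forall>a\<in>Field lam. infinite (C \<inter> e a))"

text \<open>Unlike in \<open>tower\<close>, only lower bounds that are themselves positive are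
  excluded.\<close>

definition bad_tower :: "'i rel \<Rightarrow> ('i \<Rightarrow> nat set) \<Rightarrow> bool" where
  "bad_tower r A \<longleftrightarrow> Well_order r \<and> (\<forall>i\<in>Field r. positive (A i)) \<and>
     (\<forall>i\<in>Field r. \<forall>j\<in>Field r. (i, j) \<in> r \<longrightarrow> almost_sub (A j) (A i)) \<and>
     \<not> (\<exists>C. positive C \<and> (\<forall>i\<in>Field r. almost_sub C (A i)))"

lemma Field_lam_nonempty: "Field lam \<noteq> {}"
  using infinite_Field_lam by (rule infinite_imp_nonempty)

lemma positive_infinite: "positive C \<Longrightarrow> infinite C"
  using Field_lam_nonempty unfolding positive_def by (meson ex_in_conv finite_Int)

lemma positive_Int:
  assumes "positive C" and "a \<in> Field lam"
  shows "positive (C \<inter> e a)"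
  unfolding positive_def
proof
  fix b assume "b \<in> Field lam"
  then obtain c where "c \<in> Field lam" "e c = e a \<inter> e b" using e_Int assms(2) by blast
  then show "infinite (C \<inter> e a \<inter> e b)"
    using assms(1) unfolding positive_def by (metis Int_assoc)
qed

lemma ex_bad_tower: "\<exists>(r :: nat set rel) A. bad_tower r A \<and> r <o lam"
proof (rule ccontr)
  assume no: "\<not> ?thesis"
  let ?P = "\<lambda>A a x. positive x \<and> x \<subseteq> e a \<and> (\<forall>b\<in>underS lam a. almost_sub x (A b))"
  have "\<exists>A. \<forall>a\<in>Field lam. ?P A a (A a)"
  proof (rule Well_order_dependent_choice[OF Well_order_lam, where P = ?P])
    fix a A
    assume a: "a \<in> Field lam" and IH: "\<And>b. b \<in> underS lam a \<Longrightarrow> ?P A b (A b)"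
    \<comment> \<open>The earlier stages form a chain shorter than \<open>lam\<close>. By assumption
      it is not bad, so it has a positive lower bound, whose intersection with \<open>e a\<close> is
      again positive.\<close>
    let ?r = "Restr lam (underS lam a)"
    have F: "Field ?r = underS lam a"
      using Field_Restr_Well_order[OF Well_order_lam] by (auto simp: underS_def Field_def)
    have "?r <o lam" by (rule underS_Restr_ordLess[OF Well_order_lam Field_lam_nonempty])
    then have "\<not> bad_tower ?r A" using no by blast
    moreover have "almost_sub (A c) (A b)"
      if "b \<in> underS lam a" "c \<in> underS lam a" "(b, c) \<in> lam" for b c
      using that IH[of c] by (cases "b = c") (auto simp: underS_def almost_sub_def)
    ultimately obtain C where C: "positive C" "\<forall>b\<in>underS lam a. almost_sub C (A b)"
      using IH Well_order_Restr[OF Well_order_lam, of "underS lam a"]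
      unfolding bad_tower_def F by auto
    have "almost_sub (C \<inter> e a) (A b)" if "b \<in> underS lam a" for b
      using C(2)[rule_format, OF that] unfolding almost_sub_def by (rule finite_subset[rotated]) blast
    then show "\<exists>x. ?P A a x"
      using positive_Int[OF C(1) a] by (intro exI[of _ "C \<inter> e a"]) auto
  qed auto
  then obtain A where A: "\<And>a. a \<in> Field lam \<Longrightarrow> ?P A a (A a)" by blast
  obtain C where C: "infinite C" "\<forall>a\<in>Field lam. almost_sub C (A a)"
    using decreasing_lower_bound[OF Well_order_lam lam_less, of "Field lam" UNIV A] A positive_infinite
    by auto
  have "almost_sub C (e a)" if a: "a \<in> Field lam" for a
    using C(2) A[OF a] a unfolding almost_sub_def by (meson Diff_mono finite_subset order_refl)
  then show False
    using no_pseudo_intersection C(1) unfolding pseudo_intersection_def by blast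
qed

text \<open>A lower bound for cofinally many of the sets is one for all; this forces a shortest bad
  tower to be regular.\<close>

lemma bad_tower_Restr:
  assumes bad: "bad_tower r A" and K: "K \<subseteq> Field r" "\<And>a. a \<in> Field r \<Longrightarrow> \<exists>b\<in>K. (a, b) \<in> r"
  shows "bad_tower (Restr r K) A"
proof -
  have r: "Well_order r" using bad unfolding bad_tower_def by blast
  have F: "Field (Restr r K) = K" using Field_Restr_Well_order[OF r] K(1) by blast
  have "\<forall>i\<in>Field r. almost_sub C (A i)" if C: "\<forall>i\<in>K. almost_sub C (A i)" for C
  proof
    fix i assume i: "i \<in> Field r"
    then obtain j where j: "j \<in> K" "(i, j) \<in> r" using K(2) by blast
    then have "almost_sub (A j) (A i)" using bad i K(1) unfolding bad_tower_def by blast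
    then show "almost_sub C (A i)" using C j(1) almost_sub_trans by blast
  qed
  then show ?thesis
    using bad K(1) Well_order_Restr[OF r, of K] unfolding bad_tower_def F by blast
qed

text \<open>A last set would itself be a positive lower bound.\<close>

lemma bad_tower_no_last:
  assumes bad: "bad_tower r A" and i: "i \<in> Field r"
  shows "\<exists>j\<in>Field r. (i, j) \<in> r \<and> i \<noteq> j"
proof (rule ccontr)
  assume no: "\<not> ?thesis"
  have r: "Well_order r" using bad unfolding bad_tower_def by blast
  have "(j, i) \<in> r" if j: "j \<in> Field r" for j
    by (rule Well_order_cases[OF r i j]) (use no j Well_order_refl[OF r i] in auto)
  then have "\<forall>j\<in>Field r. almost_sub (A i) (A j)"
    using bad i unfolding bad_tower_def by blast
  then show False using bad i unfolding bad_tower_def by blast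
qed

lemma bad_tower_Field_nonempty:
  assumes "bad_tower r A"
  shows "Field r \<noteq> {}"
proof
  assume "Field r = {}"
  moreover have "positive UNIV" unfolding positive_def using e_infinite by simp
  ultimately show False using assms unfolding bad_tower_def by blast
qed

text \<open>A countable chain would have a positive lower bound: collect the points of
  \<open>S n\<close> in \<open>{n..g n}\<close>, where one \<open>g\<close> dominates, for all
  \<open>a\<close> at once, the functions finding a point of
  \<open>S n \<inter> e a\<close>.\<close>

lemma bad_tower_uncountable:
  assumes bad: "bad_tower r A"
  shows "uncountable (Field r)"
proof
  assume count: "countable (Field r)"
  have r: "Well_order r" using bad unfolding bad_tower_def by blast
  have ne: "Field r \<noteq> {}" using bad by (rule bad_tower_Field_nonempty)
  let ?i = "from_nat_into (Field r)"
  have iF: "?i n \<in> Field r" for n by (rule from_nat_into[OF ne])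
  define S where "S n = (\<Inter>m\<le>n. A (?i m))" for n
  \<comment> \<open>Each finite intersection almost contains a single member of the chain, so it
    meets every \<open>e a\<close> infinitely often.\<close>
  have lower: "\<exists>j\<in>Field r. almost_sub (A j) (S n)" for n
  proof (induction n)
    case 0
    then show ?case
      using iF[of 0] unfolding S_def by (intro bexI[of _ "?i 0"]) (auto simp: almost_sub_def)
  next
    case (Suc n)
    then obtain j where j: "j \<in> Field r" "almost_sub (A j) (S n)" by blast
    have S: "S (Suc n) = S n \<inter> A (?i (Suc n))" unfolding S_def by (auto simp: le_Suc_eq)
    have Int: "almost_sub C (S (Suc n))" if "almost_sub C (S n)" "almost_sub C (A (?i (Suc n)))" for C
      using that unfolding S almost_sub_def by (simp add: Diff_Int)
    have refl: "almost_sub C C" for C by (simp add: almost_sub_def)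
    show ?case
    proof (rule Well_order_cases[OF r j(1) iF[of "Suc n"]])
      assume "(j, ?i (Suc n)) \<in> r"
      then have "almost_sub (A (?i (Suc n))) (A j)"
        using bad j(1) iF[of "Suc n"] unfolding bad_tower_def by blast
      then show ?thesis using Int[OF almost_sub_trans[OF _ j(2)] refl] iF[of "Suc n"] by blast
    next
      assume "(?i (Suc n), j) \<in> r"
      then have "almost_sub (A j) (A (?i (Suc n)))"
        using bad j(1) iF[of "Suc n"] unfolding bad_tower_def by blast
      then show ?thesis using Int[OF j(2)] j(1) by blast
    qed
  qed
  have inf: "infinite (S n \<inter> e a)" if a: "a \<in> Field lam" for n a
  proof -
    obtain j where j: "j \<in> Field r" "almost_sub (A j) (S n)" using lower by blast
    have "infinite (A j \<inter> e a)" using bad j(1) a unfolding bad_tower_def positive_def by blast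
    moreover have "almost_sub (A j \<inter> e a) (S n)"
      using j(2) unfolding almost_sub_def by (rule finite_subset[rotated]) blast
    ultimately have "infinite (A j \<inter> e a \<inter> S n)" by (rule almost_sub_infinite)
    then show ?thesis by (rule infinite_super[rotated]) blast
  qed
  have "\<forall>a n. \<exists>x. a \<in> Field lam \<longrightarrow> x \<ge> n \<and> x \<in> S n \<inter> e a"
    using inf unfolding infinite_nat_iff_unbounded_le by blast
  then obtain f where f: "\<And>a n. a \<in> Field lam \<Longrightarrow> f a n \<ge> n \<and> f a n \<in> S n \<inter> e a" by metis
  obtain g where g: "\<And>a. a \<in> Field lam \<Longrightarrow> \<forall>\<^sub>\<infinity>n. f a n \<le> g n"
    using dominating[of "Field lam" f] card_of_Field_ordIso[OF Card_order_lam] ordIso_imp_ordLeq by blast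
  define D where "D n = S n \<inter> {n..g n}" for n
  let ?C = "\<Union>n\<in>UNIV. D n"
  have "positive ?C"
    unfolding positive_def
  proof
    fix a assume a: "a \<in> Field lam"
    show "infinite (?C \<inter> e a)"
    proof (rule infinite_Int_UN_sections)
      show "\<forall>\<^sub>\<infinity>n. n \<in> UNIV \<longrightarrow> D n \<inter> e a \<inter> {n..} \<noteq> {}"
        using g[OF a]
      proof (rule eventually_mono)
        fix n assume "f a n \<le> g n"
        then have "f a n \<in> D n \<inter> e a \<inter> {n..}" using f[OF a, of n] unfolding D_def by auto
        then show "n \<in> UNIV \<longrightarrow> D n \<inter> e a \<inter> {n..} \<noteq> {}" by blast
      qed
    qed simp
  qed
  moreover have "almost_sub ?C (A i)" if i: "i \<in> Field r" for i
  proof (rule almost_sub_UN_sections)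
    obtain m where m: "?i m = i" using from_nat_into_surj[OF count i] by blast
    have "D n \<subseteq> A i" if "n \<ge> m" for n
      using that m unfolding D_def S_def by auto
    then show "\<forall>\<^sub>\<infinity>n. n \<in> UNIV \<longrightarrow> D n \<subseteq> A i" unfolding MOST_nat_le by blast
    show "finite (D n)" for n unfolding D_def by simp
  qed
  ultimately show False using bad unfolding bad_tower_def by blast
qed

text \<open>Take a bad tower of least order type. Every cofinal \<open>K\<close> carries a bad
  tower, so \<open>ordLeq_card_of_cofinal\<close> gives \<open>r \<le>o |K|\<close>. With
  \<open>K\<close> the whole field, \<open>r\<close> is a cardinal; general \<open>K\<close> gives
  regularity.\<close>

lemma ex_regular_bad_tower:
  "\<exists>(r :: nat set rel) A. bad_tower r A \<and> r <o lam \<and> Card_order r \<and> regularCard r \<and> natLeq <o r"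
proof -
  let ?R = "{r :: nat set rel. \<exists>A. bad_tower r A}"
  obtain r0 :: "nat set rel" and A0 where r0: "bad_tower r0 A0" "r0 <o lam"
    using ex_bad_tower by blast
  have "\<exists>r\<in>?R. \<forall>r'\<in>?R. r \<le>o r'"
    by (rule exists_minim_Well_order) (use r0(1) in \<open>auto simp: bad_tower_def\<close>)
  then obtain r :: "nat set rel" and A where bad: "bad_tower r A" and min: "\<And>s B. bad_tower s B \<Longrightarrow> r \<le>o (s :: nat set rel)"
    by blast
  have r: "Well_order r" using bad unfolding bad_tower_def by blast
  have less: "r <o lam" using min[OF r0(1)] r0(2) by (rule ordLeq_ordLess_trans)
  have cof: "r \<le>o |K|" if "K \<subseteq> Field r" "\<And>a. a \<in> Field r \<Longrightarrow> \<exists>b\<in>K. (a, b) \<in> r" for K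
    by (rule ordLeq_card_of_cofinal[OF r _ that]) (rule min[OF bad_tower_Restr[OF bad]])
  have card: "Card_order r"
    unfolding Card_order_iff_ordLeq_card_of using cof[of "Field r"] Well_order_refl[OF r] by blast
  have "regularCard r"
    unfolding regularCard_def
  proof (intro allI impI)
    fix K assume K: "K \<subseteq> Field r \<and> cofinal K r"
    then have "r \<le>o |K|" using cof[of K] unfolding cofinal_def by blast
    moreover have "|K| \<le>o r"
      using card_of_mono1[of K "Field r"] K card_of_Field_ordIso[OF card] ordLeq_ordIso_trans by blast
    ultimately show "|K| =o r" by (simp add: ordIso_iff_ordLeq)
  qed
  moreover have "natLeq <o r"
  proof -
    have "natLeq <o |Field r|"
      by (rule natLeq_less_uncountable[OF bad_tower_uncountable[OF bad]])
    then show ?thesis using card_of_Field_ordIso[OF card] by (rule ordLess_ordIso_trans)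
  qed
  ultimately show ?thesis using bad less card by blast
qed

end

section \<open>From an interpolation gap to a peculiar cut\<close>

text \<open>The heights in abstract form; the mutual order of the \<open>w a\<close> is not yet
  controlled. \<open>gap\<close> covers all infinite \<open>Z \<subseteq> Y\<close> because later
  constructions shrink \<open>Y\<close>; \<open>v\<close> is what everything is finally subtracted
  from.\<close>

locale interpolation_gap = p_below_t +
  fixes r :: "nat set rel" and u w :: "nat set \<Rightarrow> nat \<Rightarrow> nat" and v :: "nat \<Rightarrow> nat" and Y :: "nat set"
  assumes r: "Well_order r" "r <o lam"
    and no_last: "\<And>i. i \<in> Field r \<Longrightarrow> \<exists>j\<in>Field r. (i, j) \<in> r \<and> i \<noteq> j"
    and nonempty: "Field r \<noteq> {}"
    and Y: "infinite Y"
    and u_less: "\<And>i j. i \<in> Field r \<Longrightarrow> j \<in> underS r i \<Longrightarrow> \<forall>\<^sub>\<infinity>n. u j n < u i n"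
    and u_le_w: "\<And>i a. i \<in> Field r \<Longrightarrow> a \<in> Field lam \<Longrightarrow> \<forall>\<^sub>\<infinity>n. n \<in> Y \<longrightarrow> u i n \<le> w a n"
    and w_le_v: "\<And>a. a \<in> Field lam \<Longrightarrow> \<forall>\<^sub>\<infinity>n. n \<in> Y \<longrightarrow> w a n \<le> v n"
    and gap: "\<And>Z k. Z \<subseteq> Y \<Longrightarrow> infinite Z \<Longrightarrow> (\<And>i. i \<in> Field r \<Longrightarrow> \<forall>\<^sub>\<infinity>n. n \<in> Z \<longrightarrow> u i n \<le> k n) \<Longrightarrow>
      (\<And>a. a \<in> Field lam \<Longrightarrow> \<forall>\<^sub>\<infinity>n. n \<in> Z \<longrightarrow> k n \<le> w a n) \<Longrightarrow> False"
begin

text \<open>Strictness comes from a later index \<open>j\<close>: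
  \<open>u i < u j \<le> k\<close>.\<close>

lemma u_less_of_le:
  assumes i: "i \<in> Field r" and le: "\<And>i. i \<in> Field r \<Longrightarrow> \<forall>\<^sub>\<infinity>n. n \<in> Z \<longrightarrow> u i n \<le> k n"
  shows "\<forall>\<^sub>\<infinity>n. n \<in> Z \<longrightarrow> u i n < k n"
proof -
  obtain j where j: "j \<in> Field r" "i \<in> underS r j"
    using no_last[OF i] by (auto simp: underS_def)
  show ?thesis
    using u_less[OF j] le[OF j(1)] by eventually_elim auto
qed

text \<open>Recursion along \<open>lam\<close> on pairs of a set and a function. Each stage has
  fewer than p constraints, so \<open>selection\<close> fits a function between the
  \<open>u i\<close> and the earlier functions on a smaller infinite set; \<open>lam <o lt\<close>
  keeps these sets from dying out.\<close>

lemma ex_decreasing_below: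
  "\<exists>X G. infinite X \<and> X \<subseteq> Y \<and> (\<forall>a\<in>Field lam.
     (\<forall>b\<in>underS lam a. \<forall>\<^sub>\<infinity>n. n \<in> X \<longrightarrow> G a n < G b n) \<and>
     (\<forall>i\<in>Field r. \<forall>\<^sub>\<infinity>n. n \<in> X \<longrightarrow> u i n \<le> G a n) \<and>
     (\<forall>\<^sub>\<infinity>n. n \<in> X \<longrightarrow> G a n \<le> w a n))"
proof -
  let ?P = "\<lambda>T a p. infinite (fst p) \<and> fst p \<subseteq> Y \<and>
    (\<forall>b\<in>underS lam a. almost_sub (fst p) (fst (T b))) \<and>
    (\<forall>b\<in>underS lam a. \<forall>\<^sub>\<infinity>n. n \<in> fst p \<longrightarrow> snd p n < snd (T b) n) \<and>
    (\<forall>i\<in>Field r. \<forall>\<^sub>\<infinity>n. n \<in> fst p \<longrightarrow> u i n \<le> snd p n) \<and>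
    (\<forall>\<^sub>\<infinity>n. n \<in> fst p \<longrightarrow> snd p n \<le> w a n)"
  have "\<exists>T :: nat set \<Rightarrow> nat set \<times> (nat \<Rightarrow> nat). \<forall>a\<in>Field lam. ?P T a (T a)"
  proof (rule Well_order_dependent_choice[OF Well_order_lam, where P = ?P])
    fix a and T :: "nat set \<Rightarrow> nat set \<times> (nat \<Rightarrow> nat)"
    assume a: "a \<in> Field lam" and IH: "\<And>b. b \<in> underS lam a \<Longrightarrow> ?P T b (T b)"
    have sub: "underS lam a \<subseteq> Field lam" by (auto simp: underS_def Field_def)
    have "\<exists>X\<subseteq>Y. infinite X \<and> (\<forall>b\<in>underS lam a. almost_sub X (fst (T b)))"
      by (rule decreasing_lower_bound[OF Well_order_lam lam_less sub Y]) (simp_all add: IH)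
    then obtain X where X: "X \<subseteq> Y" "infinite X" "\<forall>b\<in>underS lam a. almost_sub X (fst (T b))"
      by (elim exE conjE)
    let ?J = "underS lam a <+> Field r"
    \<comment> \<open>Left indices ask for a value below an earlier function, right ones for a value
      above some \<open>u i\<close>.\<close>
    define E where "E = case_sum (\<lambda>b. {(n, m). m < snd (T b) n \<and> m \<le> w a n}) (\<lambda>i. {(n, m). u i n \<le> m \<and> m \<le> w a n})"
    have X_less: "\<forall>\<^sub>\<infinity>n. n \<in> X \<longrightarrow> u i n < snd (T b) n" if "i \<in> Field r" "b \<in> underS lam a" for i b
    proof -
      have "\<forall>\<^sub>\<infinity>n. n \<in> fst (T b) \<longrightarrow> u i n < snd (T b) n"
        using u_less_of_le[OF that(1)] IH[OF that(2)] by blast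
      moreover have "\<forall>\<^sub>\<infinity>n. n \<in> X \<longrightarrow> n \<in> fst (T b)"
        using X(3) that(2) unfolding almost_sub_iff_MOST by blast
      ultimately show ?thesis by eventually_elim blast
    qed
    have "\<exists>Z c. infinite Z \<and> Z \<subseteq> X \<and> (\<forall>j\<in>?J. \<forall>\<^sub>\<infinity>n. n \<in> Z \<longrightarrow> (n, c n) \<in> E j)"
    proof (rule selection)
      show "|?J| <o lam"
        by (rule card_of_Plus_ordLess_infinite_Field[OF infinite_Field_lam Card_order_lam
              card_of_underS[OF Card_order_lam a] ordLess_Field[OF r(2)]])
    next
      fix F k
      assume F: "finite F" "F \<subseteq> ?J"
      define F1 where "F1 = Inl -` F"
      define F2 where "F2 = Inr -` F"
      have fin: "finite F1" "finite F2" unfolding F1_def F2_def using F(1) by (simp_all add: finite_vimageI)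
      have F1: "F1 \<subseteq> underS lam a" and F2: "F2 \<subseteq> Field r" using F(2) unfolding F1_def F2_def by auto
      obtain i0 where i0: "i0 \<in> Field r" using nonempty by blast
      let ?I = "insert i0 F2"
      have I: "finite ?I" "?I \<subseteq> Field r" using fin F2 i0 by auto
      have "\<forall>\<^sub>\<infinity>n. \<forall>b\<in>F1. \<forall>i\<in>?I. n \<in> X \<longrightarrow> u i n < snd (T b) n"
        using fin(1) I F1 X_less by (intro eventually_ball_finite ballI) auto
      moreover have "\<forall>\<^sub>\<infinity>n. \<forall>i\<in>?I. n \<in> Y \<longrightarrow> u i n \<le> w a n"
        using I a u_le_w by (intro eventually_ball_finite ballI) auto
      ultimately have "\<forall>\<^sub>\<infinity>n. n \<in> X \<longrightarrow> (\<forall>b\<in>F1. \<forall>i\<in>?I. u i n < snd (T b) n) \<and> (\<forall>i\<in>?I. u i n \<le> w a n)"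
        by eventually_elim (use X(1) in blast)
      from infinite_imp_ex_MOST[OF X(2) this, of k] obtain n
        where n: "n \<ge> k" "n \<in> X" "\<forall>b\<in>F1. \<forall>i\<in>?I. u i n < snd (T b) n" "\<forall>i\<in>?I. u i n \<le> w a n"
        by (elim exE conjE)
      \<comment> \<open>Being one of the \<open>u i n\<close>, the maximum stays below the earlier
        functions and within \<open>w a n\<close>; \<open>i0\<close> keeps it defined when
        \<open>F2\<close> is empty.\<close>
      define m where "m = Max ((\<lambda>i. u i n) ` ?I)"
      have "m \<in> (\<lambda>i. u i n) ` ?I" unfolding m_def using I(1) by (intro Max_in) auto
      then have "(\<forall>b\<in>F1. m < snd (T b) n) \<and> m \<le> w a n" using n by auto
      moreover have "\<forall>i\<in>F2. u i n \<le> m" unfolding m_def using I(1) by simp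
      moreover have "j \<in> F1 <+> F2" if "j \<in> F" for j
        using that unfolding F1_def F2_def by (cases j) auto
      ultimately have "\<forall>j\<in>F. (n, m) \<in> E j" unfolding E_def by fastforce
      then show "\<exists>n\<ge>k. n \<in> X \<and> (\<exists>x. \<forall>j\<in>F. (n, x) \<in> E j)" using n(1,2) by blast
    qed
    then obtain Z c where Z: "infinite Z" "Z \<subseteq> X" "\<And>j. j \<in> ?J \<Longrightarrow> \<forall>\<^sub>\<infinity>n. n \<in> Z \<longrightarrow> (n, c n) \<in> E j"
      by blast
    have bE: "\<forall>\<^sub>\<infinity>n. n \<in> Z \<longrightarrow> c n < snd (T b) n" if "b \<in> underS lam a" for b
      using Z(3)[OF InlI[OF that]] by (rule eventually_mono) (simp add: E_def)
    have iE: "\<forall>\<^sub>\<infinity>n. n \<in> Z \<longrightarrow> u i n \<le> c n \<and> c n \<le> w a n" if "i \<in> Field r" for i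
      using Z(3)[OF InrI[OF that]] by (rule eventually_mono) (simp add: E_def)
    obtain i0 where i0: "i0 \<in> Field r" using nonempty by blast
    have "\<forall>\<^sub>\<infinity>n. n \<in> Z \<longrightarrow> c n \<le> w a n" using iE[OF i0] by (rule eventually_mono) simp
    moreover have "\<forall>\<^sub>\<infinity>n. n \<in> Z \<longrightarrow> u i n \<le> c n" if "i \<in> Field r" for i
      using iE[OF that] by (rule eventually_mono) simp
    moreover have "almost_sub Z (fst (T b))" if "b \<in> underS lam a" for b
      using X(3) that Z(2) almost_sub_trans[of Z X] by (simp add: almost_sub_def Diff_eq_empty_iff[THEN iffD2])
    ultimately show "\<exists>p. ?P T a p"
      using Z(1,2) X(1) bE by (intro exI[of _ "(Z, c)"]) auto
  qed auto
  then obtain T where T: "\<And>a. a \<in> Field lam \<Longrightarrow> ?P T a (T a)" by blast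
  have "\<exists>X\<subseteq>Y. infinite X \<and> (\<forall>a\<in>Field lam. almost_sub X (fst (T a)))"
    by (rule decreasing_lower_bound[OF Well_order_lam lam_less subset_refl Y]) (simp_all add: T)
  then obtain X where X: "X \<subseteq> Y" "infinite X" "\<forall>a\<in>Field lam. almost_sub X (fst (T a))"
    by (elim exE conjE)
  have mono: "\<forall>\<^sub>\<infinity>n. n \<in> X \<longrightarrow> Q n" if "a \<in> Field lam" "\<forall>\<^sub>\<infinity>n. n \<in> fst (T a) \<longrightarrow> Q n" for a Q
  proof -
    have "\<forall>\<^sub>\<infinity>n. n \<in> X \<longrightarrow> n \<in> fst (T a)"
      using X(3) that(1) unfolding almost_sub_iff_MOST by blast
    then show ?thesis using that(2) by eventually_elim blast
  qed
  show ?thesis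
    by (rule exI[of _ X], rule exI[of _ "\<lambda>a. snd (T a)"], intro conjI ballI)
      (simp_all add: X(1,2) T mono)
qed

lemma ex_peculiar_cut: "\<exists>F G. peculiar_cut r lam F G"
proof -
  obtain X G where X: "infinite X" "X \<subseteq> Y"
    and G_less: "\<And>a b. a \<in> Field lam \<Longrightarrow> b \<in> underS lam a \<Longrightarrow> \<forall>\<^sub>\<infinity>n. n \<in> X \<longrightarrow> G a n < G b n"
    and u_le_G: "\<And>i a. i \<in> Field r \<Longrightarrow> a \<in> Field lam \<Longrightarrow> \<forall>\<^sub>\<infinity>n. n \<in> X \<longrightarrow> u i n \<le> G a n"
    and G_le_w: "\<And>a. a \<in> Field lam \<Longrightarrow> \<forall>\<^sub>\<infinity>n. n \<in> X \<longrightarrow> G a n \<le> w a n"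
    using ex_decreasing_below by blast
  \<comment> \<open>Enumerating \<open>X\<close> carries relations that hold only on
    \<open>X\<close> over to all of \<open>nat\<close>.\<close>
  define h where "h = enumerate X"
  have h: "inj h" "range h = X"
    unfolding h_def using X(1) strict_mono_enumerate range_enumerate strict_mono_imp_inj_on by blast+
  have hX: "h m \<in> X" for m using h(2) by blast
  have pull: "\<forall>\<^sub>\<infinity>m. Q (h m)" if "\<forall>\<^sub>\<infinity>n. n \<in> X \<longrightarrow> Q n" for Q
    using MOST_inj[OF that h(1)] hX by simp
  have uu: "\<forall>\<^sub>\<infinity>m. u j (h m) < u i (h m)" if "i \<in> Field r" "j \<in> underS r i" for i j
    by (rule MOST_inj[OF u_less[OF that] h(1)])
  have GG: "\<forall>\<^sub>\<infinity>m. G a (h m) < G b (h m)" if "a \<in> Field lam" "b \<in> underS lam a" for a b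
    by (rule pull[OF G_less[OF that]])
  have uG: "\<forall>\<^sub>\<infinity>m. u i (h m) < G a (h m)" if "i \<in> Field r" "a \<in> Field lam" for i a
    by (rule pull[OF u_less_of_le[OF that(1) u_le_G[OF _ that(2)]]])
  have Gw: "\<forall>\<^sub>\<infinity>m. G a (h m) \<le> w a (h m)" if "a \<in> Field lam" for a
    by (rule pull[OF G_le_w[OF that]])
  have Gv: "\<forall>\<^sub>\<infinity>m. G a (h m) \<le> v (h m)" if "a \<in> Field lam" for a
  proof -
    have "\<forall>\<^sub>\<infinity>m. w a (h m) \<le> v (h m)"
      using MOST_inj[OF w_le_v[OF that] h(1)] hX X(2) by (auto elim!: eventually_mono)
    then show ?thesis using Gw[OF that] by eventually_elim simp
  qed
  obtain a0 where a0: "a0 \<in> Field lam" using infinite_Field_lam by fastforce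
  have uv: "\<forall>\<^sub>\<infinity>m. u i (h m) < v (h m)" if "i \<in> Field r" for i
    using uG[OF that a0] Gv[OF a0] by eventually_elim simp
  have no_between: False
    if W: "infinite W" and lower: "\<And>i. i \<in> Field r \<Longrightarrow> \<forall>\<^sub>\<infinity>m. m \<in> W \<longrightarrow> u i (h m) \<le> k m"
      and upper: "\<And>a. a \<in> Field lam \<Longrightarrow> \<forall>\<^sub>\<infinity>m. m \<in> W \<longrightarrow> k m \<le> G a (h m)" for W k
  proof (rule gap[of "h ` W" "\<lambda>n. k (inv h n)"])
    show "h ` W \<subseteq> Y" using hX X(2) by blast
    show "infinite (h ` W)"
      using W h(1) finite_imageD inj_on_subset by blast
    show "\<forall>\<^sub>\<infinity>n. n \<in> h ` W \<longrightarrow> u i n \<le> k (inv h n)" if "i \<in> Field r" for i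
      by (rule MOST_image) (use lower[OF that] in \<open>simp add: inv_f_f[OF h(1)]\<close>)
    show "\<forall>\<^sub>\<infinity>n. n \<in> h ` W \<longrightarrow> k (inv h n) \<le> w a n" if "a \<in> Field lam" for a
    proof (rule MOST_image)
      show "\<forall>\<^sub>\<infinity>m. m \<in> W \<longrightarrow> k (inv h (h m)) \<le> w a (h m)"
        using upper[OF that] Gw[OF that] by eventually_elim (auto simp: inv_f_f[OF h(1)])
    qed
  qed
  \<comment> \<open>Truncation is harmless, as \<open>u i\<close> and \<open>G a\<close> almost
    everywhere do not exceed \<open>v\<close>. The reversal turns the increasing \<open>u i\<close>
    into the decreasing side of the cut.\<close>
  define F' where "F' i m = v (h m) - u i (h m)" for i m
  define G' where "G' a m = v (h m) - G a (h m)" for a m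
  have r_less: "r <o lt" using r(2) lam_less by (rule ordLess_transitive)
  have "less_star (F' j) (F' i)" if "i \<in> Field r" "j \<in> Field r" "(i, j) \<in> r" "i \<noteq> j" for i j
  proof -
    have "i \<in> underS r j" using that by (simp add: underS_def)
    from uu[OF that(2) this] uv[OF that(2)] show ?thesis
      unfolding less_star_iff_MOST F'_def by eventually_elim simp
  qed
  moreover have "less_star (G' a) (G' b)" if "a \<in> Field lam" "b \<in> Field lam" "(a, b) \<in> lam" "a \<noteq> b" for a b
  proof -
    have "a \<in> underS lam b" using that by (simp add: underS_def)
    from GG[OF that(2) this] Gv[OF that(1)] show ?thesis
      unfolding less_star_iff_MOST G'_def by eventually_elim simp
  qed
  moreover have "less_star (G' a) (F' i)" if "i \<in> Field r" "a \<in> Field lam" for i a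
    using uG[OF that] Gv[OF that(2)] unfolding less_star_iff_MOST F'_def G'_def by eventually_elim simp
  moreover have "\<exists>a\<in>Field lam. le_star f (G' a)" if f: "\<And>i. i \<in> Field r \<Longrightarrow> le_star f (F' i)" for f
  proof (rule ccontr)
    assume no: "\<not> ?thesis"
    \<comment> \<open>As \<open>a\<close> grows, so does \<open>G' a\<close>, and the sets where
      \<open>f\<close> exceeds it shrink. On a pseudo-intersection \<open>W\<close> the function
      \<open>v - f\<close>, read along \<open>h\<close>, interpolates.\<close>
    have "\<exists>W\<subseteq>UNIV. infinite W \<and> (\<forall>a\<in>Field lam. almost_sub W {m. \<not> f m \<le> G' a m})"
    proof (rule decreasing_lower_bound[OF Well_order_lam lam_less subset_refl])
      show "infinite {m. \<not> f m \<le> G' a m}" if "a \<in> Field lam" for a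
        using no that unfolding le_star_def by blast
      show "almost_sub {m. \<not> f m \<le> G' b m} {m. \<not> f m \<le> G' a m}"
        if "b \<in> Field lam" "a \<in> underS lam b" for a b
        using GG[OF that] unfolding almost_sub_iff_MOST G'_def by eventually_elim auto
    qed auto
    then obtain W where W: "infinite W" "\<And>a. a \<in> Field lam \<Longrightarrow> \<forall>\<^sub>\<infinity>m. m \<in> W \<longrightarrow> \<not> f m \<le> G' a m"
      unfolding almost_sub_iff_MOST by auto
    show False
    proof (rule no_between[OF W(1), of "\<lambda>m. v (h m) - f m"])
      show "\<forall>\<^sub>\<infinity>m. m \<in> W \<longrightarrow> u i (h m) \<le> v (h m) - f m" if "i \<in> Field r" for i
        using f[OF that] uv[OF that] unfolding le_star_iff_MOST F'_def
        by eventually_elim (intro impI, linarith)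
      show "\<forall>\<^sub>\<infinity>m. m \<in> W \<longrightarrow> v (h m) - f m \<le> G a (h m)" if "a \<in> Field lam" for a
        using W(2)[OF that] unfolding G'_def by (rule eventually_mono) auto
    qed
  qed
  moreover have "\<exists>i\<in>Field r. le_star (F' i) f" if f: "\<And>a. a \<in> Field lam \<Longrightarrow> le_star (G' a) f" for f
  proof (rule ccontr)
    assume no: "\<not> ?thesis"
    \<comment> \<open>Dually, the sets where \<open>F' i\<close> exceeds \<open>f\<close> shrink
      along \<open>r\<close>, which is also shorter than t.\<close>
    have "\<exists>W\<subseteq>UNIV. infinite W \<and> (\<forall>i\<in>Field r. almost_sub W {m. \<not> F' i m \<le> f m})"
    proof (rule decreasing_lower_bound[OF r(1) r_less subset_refl])
      show "infinite {m. \<not> F' i m \<le> f m}" if "i \<in> Field r" for i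
        using no that unfolding le_star_def by blast
      show "almost_sub {m. \<not> F' i m \<le> f m} {m. \<not> F' j m \<le> f m}"
        if "i \<in> Field r" "j \<in> underS r i" for i j
        using uu[OF that] unfolding almost_sub_iff_MOST F'_def by eventually_elim auto
    qed auto
    then obtain W where W: "infinite W" "\<And>i. i \<in> Field r \<Longrightarrow> \<forall>\<^sub>\<infinity>m. m \<in> W \<longrightarrow> \<not> F' i m \<le> f m"
      unfolding almost_sub_iff_MOST by auto
    show False
    proof (rule no_between[OF W(1), of "\<lambda>m. v (h m) - f m"])
      show "\<forall>\<^sub>\<infinity>m. m \<in> W \<longrightarrow> u i (h m) \<le> v (h m) - f m" if "i \<in> Field r" for i
        using W(2)[OF that] unfolding F'_def by (rule eventually_mono) auto
      show "\<forall>\<^sub>\<infinity>m. m \<in> W \<longrightarrow> v (h m) - f m \<le> G a (h m)" if "a \<in> Field lam" for a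
        using f[OF that] unfolding G'_def le_star_iff_MOST by (rule eventually_mono) auto
    qed
  qed
  ultimately have "peculiar_cut r lam F' G'"
    unfolding peculiar_cut_def by (intro conjI ballI allI impI) blast+
  then show ?thesis by blast
qed

end

section \<open>From the tower to the gap\<close>

context p_closed_family
begin

text \<open>There are at most p pairs \<open>(i, a)\<close>, so one \<open>g\<close> dominates all
  functions finding a point of \<open>A i \<inter> e a\<close> at or beyond
  \<open>n\<close>.\<close>

lemma ex_interval_bound:
  assumes bad: "bad_tower r A" and less: "r <o lam"
  shows "\<exists>g. \<forall>i\<in>Field r. \<forall>a\<in>Field lam. \<forall>\<^sub>\<infinity>n. A i \<inter> e a \<inter> {n..g n} \<noteq> {}"
proof -
  have "\<forall>p n. \<exists>x. p \<in> Field r \<times> Field lam \<longrightarrow> x \<ge> n \<and> x \<in> A (fst p) \<inter> e (snd p)"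
  proof (intro allI)
    fix p n
    show "\<exists>x. p \<in> Field r \<times> Field lam \<longrightarrow> x \<ge> n \<and> x \<in> A (fst p) \<inter> e (snd p)"
    proof (cases "p \<in> Field r \<times> Field lam")
      case True
      then have "infinite (A (fst p) \<inter> e (snd p))"
        using bad unfolding bad_tower_def positive_def by auto
      then show ?thesis unfolding infinite_nat_iff_unbounded_le by blast
    qed blast
  qed
  then obtain f where f: "\<And>p n. p \<in> Field r \<times> Field lam \<Longrightarrow> f p n \<ge> n \<and> f p n \<in> A (fst p) \<inter> e (snd p)"
    by metis
  have "|Field r \<times> Field lam| \<le>o lam"
    by (rule card_of_Times_ordLeq_infinite_Field[OF infinite_Field_lam
          ordLess_imp_ordLeq[OF ordLess_Field[OF less]]
          ordIso_imp_ordLeq[OF card_of_Field_ordIso[OF Card_order_lam]] Card_order_lam])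
  then obtain g where g: "\<forall>p\<in>Field r \<times> Field lam. \<forall>\<^sub>\<infinity>n. f p n \<le> g n" using dominating by blast
  have "\<forall>\<^sub>\<infinity>n. A i \<inter> e a \<inter> {n..g n} \<noteq> {}" if "i \<in> Field r" "a \<in> Field lam" for i a
  proof -
    have p: "(i, a) \<in> Field r \<times> Field lam" using that by blast
    show ?thesis
      using g[rule_format, OF p]
    proof (rule eventually_mono)
      fix n assume "f (i, a) n \<le> g n"
      then have "f (i, a) n \<in> A i \<inter> e a \<inter> {n..g n}" using f[OF p, of n] by simp
      then show "A i \<inter> e a \<inter> {n..g n} \<noteq> {}" by blast
    qed
  qed
  then show ?thesis by blast
qed

text \<open>The values of \<open>H n\<close> on \<open>{n..g n}\<close> are chosen as a list because selection needs countably many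
  candidates. Positivity of \<open>u\<close> keeps height 0 for points outside all the sets.\<close>

lemma ex_height_function:
  fixes u :: "'i \<Rightarrow> nat \<Rightarrow> nat"
  assumes bad: "bad_tower r A" and less: "r <o lam"
    and pos: "\<And>i n. i \<in> Field r \<Longrightarrow> 0 < u i n"
    and u: "\<And>i j. i \<in> Field r \<Longrightarrow> j \<in> underS r i \<Longrightarrow> \<forall>\<^sub>\<infinity>n. u j n < u i n"
  shows "\<exists>Y H. infinite Y \<and> (\<forall>i\<in>Field r. \<forall>\<^sub>\<infinity>n. n \<in> Y \<longrightarrow> (\<forall>x\<in>{n..g n}. x \<in> A i \<longleftrightarrow> u i n \<le> H n x))"
proof -
  have r: "Well_order r" using bad unfolding bad_tower_def by blast
  define E :: "'i \<Rightarrow> (nat \<times> nat list) set"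
    where "E i = {(n, L). \<forall>x\<in>{n..g n}. x \<in> A i \<longleftrightarrow> u i n \<le> L ! x}" for i
  have "\<exists>Y c. infinite Y \<and> Y \<subseteq> UNIV \<and> (\<forall>i\<in>Field r. \<forall>\<^sub>\<infinity>n. n \<in> Y \<longrightarrow> (n, c n) \<in> E i)"
  proof (rule selection)
    show "|Field r| <o lam" by (rule ordLess_Field[OF less])
  next
    fix F k assume F: "finite F" "F \<subseteq> Field r"
    \<comment> \<open>For finitely many indices, some \<open>n\<close> is late enough that the
      inclusions are exact from \<open>n\<close> on and the \<open>u i n\<close> are in strict
      order.\<close>
    have "\<forall>\<^sub>\<infinity>n. u j n < u i n \<and> (\<forall>x\<ge>n. x \<in> A i \<longrightarrow> x \<in> A j)" if ij: "i \<in> Field r" "j \<in> underS r i" for i j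
    proof -
      have "(j, i) \<in> r" "j \<in> Field r" using ij(2) by (auto simp: underS_def Field_def)
      then have "\<forall>\<^sub>\<infinity>x. x \<in> A i \<longrightarrow> x \<in> A j"
        using bad ij(1) unfolding bad_tower_def almost_sub_iff_MOST by blast
      then have "\<forall>\<^sub>\<infinity>n. \<forall>x\<ge>n. x \<in> A i \<longrightarrow> x \<in> A j" unfolding MOST_nat_le by (meson order_trans)
      then show ?thesis using u[OF ij] by eventually_elim blast
    qed
    then have "\<forall>\<^sub>\<infinity>n. \<forall>i\<in>F. \<forall>j\<in>{j\<in>F. j \<in> underS r i}. u j n < u i n \<and> (\<forall>x\<ge>n. x \<in> A i \<longrightarrow> x \<in> A j)"
      using F by (intro eventually_ball_finite ballI) auto
    then obtain n where n: "n \<ge> k"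
      "\<And>i j. i \<in> F \<Longrightarrow> j \<in> F \<Longrightarrow> j \<in> underS r i \<Longrightarrow> u j n < u i n \<and> (\<forall>x\<ge>n. x \<in> A i \<longrightarrow> x \<in> A j)"
      unfolding MOST_nat_le by (metis (mono_tags, lifting) mem_Collect_eq nat_le_linear)
    define M where "M x = Max (insert 0 ((\<lambda>i. u i n) ` {i\<in>F. x \<in> A i}))" for x
    have "x \<in> A i \<longleftrightarrow> u i n \<le> M x" if i: "i \<in> F" and x: "x \<ge> n" for i x
    proof
      assume "x \<in> A i"
      then show "u i n \<le> M x" unfolding M_def using F(1) i by (intro Max_ge) auto
    next
      assume le: "u i n \<le> M x"
      have "M x \<in> insert 0 ((\<lambda>i. u i n) ` {i\<in>F. x \<in> A i})"
        unfolding M_def using F(1) by (intro Max_in) auto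
      moreover have "M x \<noteq> 0" using le pos[of i n] i F(2) by auto
      ultimately obtain j where j: "j \<in> F" "x \<in> A j" "M x = u j n" by auto
      have iF: "i \<in> Field r" and jF: "j \<in> Field r" using i j(1) F(2) by auto
      \<comment> \<open>The height \<open>M x\<close> is attained at \<open>j\<close>. If
        \<open>j\<close> is \<open>i\<close> or later, \<open>A j\<close> lies in \<open>A i\<close>
        from \<open>n\<close> on; an earlier \<open>j\<close> would give
        \<open>u j n < u i n\<close>.\<close>
      show "x \<in> A i"
      proof (rule Well_order_cases[OF r iF jF])
        assume "(i, j) \<in> r"
        then show ?thesis
          using n(2)[OF j(1) i] j(2) x by (cases "i = j") (auto simp: underS_def)
      next
        assume "(j, i) \<in> r" "i \<noteq> j"
        then have "u j n < u i n" using n(2)[OF i j(1)] by (auto simp: underS_def)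
        then show ?thesis using le j(3) by simp
      qed
    qed
    \<comment> \<open>The \<open>Suc\<close> makes the right endpoint \<open>g n\<close> a valid
      index.\<close>
    moreover have "map M [0..<Suc (g n)] ! x = M x" if "x \<le> g n" for x
      using that by (simp del: upt_Suc)
    ultimately have "\<forall>i\<in>F. (n, map M [0..<Suc (g n)]) \<in> E i"
      unfolding E_def by (auto simp del: upt_Suc)
    then show "\<exists>n\<ge>k. n \<in> UNIV \<and> (\<exists>L. \<forall>i\<in>F. (n, L) \<in> E i)" using n(1) by blast
  qed
  then obtain Y c where "infinite Y" "\<forall>i\<in>Field r. \<forall>\<^sub>\<infinity>n. n \<in> Y \<longrightarrow> (n, c n) \<in> E i" by blast
  then show ?thesis
    unfolding E_def by (intro exI[of _ Y] exI[of _ "\<lambda>n x. c n ! x"]) simp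
qed

lemma bad_tower_interpolation_gap:
  fixes r :: "nat set rel"
  assumes bad: "bad_tower r A" and less: "r <o lam"
  shows "\<exists>u w v Y. interpolation_gap lam lt r u w v Y"
proof -
  have r: "Well_order r" using bad unfolding bad_tower_def by blast
  have ne: "Field r \<noteq> {}" using bad by (rule bad_tower_Field_nonempty)
  obtain u :: "nat set \<Rightarrow> nat \<Rightarrow> nat" where pos: "\<And>i n. i \<in> Field r \<Longrightarrow> 0 < u i n"
    and u: "\<And>i j. i \<in> Field r \<Longrightarrow> j \<in> underS r i \<Longrightarrow> \<forall>\<^sub>\<infinity>n. u j n < u i n"
    using ex_strictly_increasing[OF r less] by blast
  obtain g where g: "\<And>i a. i \<in> Field r \<Longrightarrow> a \<in> Field lam \<Longrightarrow> \<forall>\<^sub>\<infinity>n. A i \<inter> e a \<inter> {n..g n} \<noteq> {}"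
    using ex_interval_bound[OF bad less] by blast
  have "\<exists>Y H. infinite Y \<and>
      (\<forall>i\<in>Field r. \<forall>\<^sub>\<infinity>n. n \<in> Y \<longrightarrow> (\<forall>x\<in>{n..g n}. x \<in> A i \<longleftrightarrow> u i n \<le> H n x))"
    by (rule ex_height_function[OF bad less pos u])
  then obtain Y H where Y: "infinite Y"
    and H: "\<And>i. i \<in> Field r \<Longrightarrow> \<forall>\<^sub>\<infinity>n. n \<in> Y \<longrightarrow> (\<forall>x\<in>{n..g n}. x \<in> A i \<longleftrightarrow> u i n \<le> H n x)"
    by (elim exE conjE) (erule that, erule bspec)
  define w where "w a n = Max (H n ` (e a \<inter> {n..g n}))" for a n
  define v where "v n = Max (H n ` {n..g n})" for n
  \<comment> \<open>For almost all \<open>n\<close> the maximum in \<open>w a n\<close> is thus over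
    a nonempty set.\<close>
  have ea: "\<forall>\<^sub>\<infinity>n. e a \<inter> {n..g n} \<noteq> {}" if a: "a \<in> Field lam" for a
  proof -
    obtain i where i: "i \<in> Field r" using ne by blast
    show ?thesis using g[OF i a] by (rule eventually_mono) blast
  qed
  have "interpolation_gap lam lt r u w v Y"
  proof (unfold_locales)
    show "Well_order r" "r <o lam" "Field r \<noteq> {}" "infinite Y" using r less ne Y by auto
    show "\<exists>j\<in>Field r. (i, j) \<in> r \<and> i \<noteq> j" if "i \<in> Field r" for i
      by (rule bad_tower_no_last[OF bad that])
    show "\<forall>\<^sub>\<infinity>n. u j n < u i n" if "i \<in> Field r" "j \<in> underS r i" for i j by (rule u[OF that])
    show "\<forall>\<^sub>\<infinity>n. n \<in> Y \<longrightarrow> u i n \<le> w a n" if "i \<in> Field r" "a \<in> Field lam" for i a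
      using g[OF that] H[OF that(1)]
    proof eventually_elim
      fix n assume ne: "A i \<inter> e a \<inter> {n..g n} \<noteq> {}"
        and n: "n \<in> Y \<longrightarrow> (\<forall>x\<in>{n..g n}. x \<in> A i \<longleftrightarrow> u i n \<le> H n x)"
      then obtain x where x: "x \<in> A i" "x \<in> e a" "x \<in> {n..g n}" by blast
      then have "H n x \<le> w a n" unfolding w_def by (intro Max_ge) auto
      then show "n \<in> Y \<longrightarrow> u i n \<le> w a n" using n x by auto
    qed
    show "\<forall>\<^sub>\<infinity>n. n \<in> Y \<longrightarrow> w a n \<le> v n" if "a \<in> Field lam" for a
      using ea[OF that] by (rule eventually_mono) (auto simp: w_def v_def intro!: Max_mono)
    show False
      if Z: "Z \<subseteq> Y" "infinite Z" and lower: "\<And>i. i \<in> Field r \<Longrightarrow> \<forall>\<^sub>\<infinity>n. n \<in> Z \<longrightarrow> u i n \<le> k n"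
        and upper: "\<And>a. a \<in> Field lam \<Longrightarrow> \<forall>\<^sub>\<infinity>n. n \<in> Z \<longrightarrow> k n \<le> w a n" for Z k
    proof -
      define D where "D n = {x \<in> {n..g n}. k n \<le> H n x}" for n
      have "positive (\<Union>n\<in>Z. D n)"
        unfolding positive_def
      proof
        fix a assume a: "a \<in> Field lam"
        have "\<forall>\<^sub>\<infinity>n. n \<in> Z \<longrightarrow> D n \<inter> e a \<inter> {n..} \<noteq> {}"
          using ea[OF a] upper[OF a]
        proof eventually_elim
          fix n assume ne: "e a \<inter> {n..g n} \<noteq> {}" and n: "n \<in> Z \<longrightarrow> k n \<le> w a n"
          have "w a n \<in> H n ` (e a \<inter> {n..g n})" unfolding w_def using ne by (intro Max_in) auto
          then show "n \<in> Z \<longrightarrow> D n \<inter> e a \<inter> {n..} \<noteq> {}" using n unfolding D_def by auto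
        qed
        with Z(2) show "infinite ((\<Union>n\<in>Z. D n) \<inter> e a)" by (rule infinite_Int_UN_sections)
      qed
      moreover have "almost_sub (\<Union>n\<in>Z. D n) (A i)" if i: "i \<in> Field r" for i
      proof (rule almost_sub_UN_sections)
        show "finite (D n)" for n unfolding D_def by simp
        show "\<forall>\<^sub>\<infinity>n. n \<in> Z \<longrightarrow> D n \<subseteq> A i"
          using H[OF i] lower[OF i] by eventually_elim (use Z(1) in \<open>auto simp: D_def\<close>)
      qed
      ultimately show False using bad unfolding bad_tower_def by blast
    qed
  qed
  then show ?thesis by blast
qed

end

theorem theorem2p11:
  assumes "p_less_t"
    and "is_p lam"
  shows "\<exists>(kap :: nat set rel) (F :: nat set \<Rightarrow> nat \<Rightarrow> nat) (G :: nat set \<Rightarrow> nat \<Rightarrow> nat).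
           Card_order kap \<and> regularCard kap \<and> aleph1_le kap \<and> ord_less kap lam \<and>
           peculiar_cut kap lam F G"
proof -
  obtain lp lt where lp: "is_p lp" "is_t lt" "lp <o lt"
    using assms(1) unfolding p_less_t_def by blast
  \<comment> \<open>\<open>lp\<close> and \<open>lam\<close> both represent p; minimality of
    \<open>lam\<close> against a witness of size \<open>lp\<close> transfers \<open>lp <o lt\<close>
    to \<open>lam\<close>.\<close>
  obtain \<B> where "p_family \<B>" "|\<B>| =o lp" using lp(1) unfolding is_p_def by blast
  then have "lam \<le>o lp"
    using assms(2) ordLeq_ordIso_trans unfolding is_p_def by blast
  then have "lam <o lt" using lp(3) by (rule ordLeq_ordLess_trans)
  then interpret p_below_t lam lt using assms(2) lp(2) by unfold_locales
  obtain e where e: "\<forall>a\<in>Field lam. infinite (e a)"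
    "\<forall>a\<in>Field lam. \<forall>b\<in>Field lam. \<exists>c\<in>Field lam. e c = e a \<inter> e b"
    "\<not> (\<exists>A. pseudo_intersection A (e ` Field lam))"
    using ex_closed_family by (elim exE conjE)
  interpret p_closed_family lam lt e by unfold_locales (use e in simp_all)
  obtain r :: "nat set rel" and A where r: "bad_tower r A" "r <o lam" "Card_order r" "regularCard r" "natLeq <o r"
    using ex_regular_bad_tower by blast
  obtain u w v Y where "interpolation_gap lam lt r u w v Y"
    using bad_tower_interpolation_gap[OF r(1,2)] by blast
  then obtain F G where "peculiar_cut r lam F G"
    using interpolation_gap.ex_peculiar_cut[of lam lt r u w v Y] by blast
  then show ?thesis using r unfolding aleph1_le_def ord_less_def by blast
qed

end
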